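(* Let $J=[0,1]$, let $\mu$ be a positive, $\sigma$-finite, non-atomic Borel measure on $J$, and let $\lambda$ (also written $dx$) be Lebesgue measure on $J$. If $\varphi\in C_c^\infty(J)$ and $f\in dom(T_\mu)$, then $$-\int \varphi' f\,dx=\int_J \varphi\,(T_\mu f)\,d\mu ;$$ so we obtain the dual pair of operators $$T_\mu:\mathscr{L}^2(\mu)\longrightarrow L^2(\mu),\qquad D=-\frac{d}{dx}:L^2(\mu)\longrightarrow \mathscr{L}^2(\mu).$$ Here $\mathscr{L}^2(\mu):=\overline{dom(T_\mu)}^{L^2(\lambda)}$, i.e. the $L^2(\lambda)$-closure of $dom(T_\mu)$.
   Context: $dom(T_\mu)=\mathscr{D}_1$ is the set of functions $f$ for which there is $f^{(\mu)}\in L^2(\mu)$ with $f(x)=f(0)+\int_0^x f^{(\mu)}\,d\mu$ for all $x\in[0,1]$, and $T_\mu f:=f^{(\mu)}$ (also written $\nabla_\mu f$); it is the Radon-Nikodym derivative $df/d\mu$ of the Stieltjes measure $df$ with respect to $\mu$. $C_c^\infty(J)$ denotes smooth functions compactly supported in the interior of $J$. Dual pair (symmetric pair): for Hilbert spaces $\mathscr{H}_1,\mathscr{H}_2$ with given dense subspaces $\mathscr{D}_i\subset\mathscr{H}_i$, operators $T:\mathscr{H}_1\to\mathscr{H}_2$ and $S:\mathscr{H}_2\to\mathscr{H}_1$ with $dom(T)=\mathscr{D}_1$, $dom(S)=\mathscr{D}_2$ form a symmetric pair $(S,T)$ if $\langle Tu,v\rangle_{\mathscr{H}_2}=\langle u,Sv\rangle_{\mathscr{H}_1}$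 for all $u\in\mathscr{D}_1$, $v\in\mathscr{D}_2$. Here $\mathscr{H}_1=\mathscr{L}^2(\mu)$ (with the inner product of $L^2(\lambda)$), $\mathscr{H}_2=L^2(\mu)$, $T=T_\mu$, $S=D$, and $D$ acts on $\varphi\in C_c^\infty(J)$.
   Formalization: D sends φ to the orthogonal projection of -φ' onto 𝓛²(μ) (equal to -φ' when -φ' lies there), as -φ' can lie outside, e.g. for Cantor measure; the densely defined dual pair is asserted when C_c^∞(J) ⊂ L²(μ), otherwise only the adjoint relation on C_c^∞(J)∩L²(μ). *)

theory Defs
  imports "HOL-Analysis.Analysis"
begin

(* Real L2 spaces are handled through representatives: an element is a square integrable
   function, equality of elements is equality almost everywhere, and a closed subspace of
   L2(M) is a set of representatives. *)

definition L2 :: "'a measure \<Rightarrow> ('a \<Rightarrow> real) set" where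
  "L2 M = {f \<in> borel_measurable M. integrable M (\<lambda>x. (f x)\<^sup>2)}"

definition l2_inner :: "'a measure \<Rightarrow> ('a \<Rightarrow> real) \<Rightarrow> ('a \<Rightarrow> real) \<Rightarrow> real" where
  "l2_inner M f g = (\<integral>x. f x * g x \<partial>M)"

definition l2_norm :: "'a measure \<Rightarrow> ('a \<Rightarrow> real) \<Rightarrow> real" where
  "l2_norm M f = sqrt (l2_inner M f f)"

definition l2_closure :: "'a measure \<Rightarrow> ('a \<Rightarrow> real) set \<Rightarrow> ('a \<Rightarrow> real) set" where
  "l2_closure M A = {g \<in> L2 M. \<forall>e>0. \<exists>f\<in>A. l2_norm M (\<lambda>x. f x - g x) < e}"

definition fun_subspace :: "('a \<Rightarrow> real) set \<Rightarrow> bool" where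
  "fun_subspace D \<longleftrightarrow>
     (\<lambda>x. 0) \<in> D \<and> (\<forall>u\<in>D. \<forall>v\<in>D. \<forall>a b. (\<lambda>x. a * u x + b * v x) \<in> D)"

(* Closed subspaces of L2(M): the Hilbert spaces in play. *)
definition l2_hilbert :: "'a measure \<Rightarrow> ('a \<Rightarrow> real) set \<Rightarrow> bool" where
  "l2_hilbert M H \<longleftrightarrow> H \<subseteq> L2 M \<and> fun_subspace H \<and> l2_closure M H = H"

definition l2_dense_subspace ::
  "'a measure \<Rightarrow> ('a \<Rightarrow> real) set \<Rightarrow> ('a \<Rightarrow> real) set \<Rightarrow> bool" where
  "l2_dense_subspace M H D \<longleftrightarrow> D \<subseteq> H \<and> fun_subspace D \<and> H \<subseteq> l2_closure M D"

(* A linear operator with domain D (representatives in L2(M)) and values in K (inside L2(N)).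
   Linearity and independence of representatives are required almost everywhere, i.e. for
   the induced operator on classes. *)
definition l2_operator ::
  "'a measure \<Rightarrow> ('a \<Rightarrow> real) set \<Rightarrow> 'b measure \<Rightarrow> ('b \<Rightarrow> real) set \<Rightarrow>
   (('a \<Rightarrow> real) \<Rightarrow> 'b \<Rightarrow> real) \<Rightarrow> bool" where
  "l2_operator M D N K A \<longleftrightarrow>
     D \<subseteq> L2 M \<and> fun_subspace D \<and> (\<forall>u\<in>D. A u \<in> K) \<and>
     (\<forall>u\<in>D. \<forall>v\<in>D. \<forall>a b.
        AE x in N. A (\<lambda>y. a * u y + b * v y) x = a * A u x + b * A v x) \<and>
     (\<forall>u\<in>D. \<forall>v\<in>D. (AE x in M. u x = v x) \<longrightarrow> (AE x in N. A u x = A v x))"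

(* The symmetric pair property, except for density of the domains. *)
definition formally_adjoint ::
  "'a measure \<Rightarrow> ('a \<Rightarrow> real) set \<Rightarrow> ('a \<Rightarrow> real) set \<Rightarrow>
   'b measure \<Rightarrow> ('b \<Rightarrow> real) set \<Rightarrow> ('b \<Rightarrow> real) set \<Rightarrow>
   (('a \<Rightarrow> real) \<Rightarrow> 'b \<Rightarrow> real) \<Rightarrow> (('b \<Rightarrow> real) \<Rightarrow> 'a \<Rightarrow> real) \<Rightarrow> bool" where
  "formally_adjoint M1 H1 D1 M2 H2 D2 T S \<longleftrightarrow>
     l2_hilbert M1 H1 \<and> l2_hilbert M2 H2 \<and> D1 \<subseteq> H1 \<and> D2 \<subseteq> H2 \<and>
     l2_operator M1 D1 M2 H2 T \<and> l2_operator M2 D2 M1 H1 S \<and>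
     (\<forall>u\<in>D1. \<forall>v\<in>D2. l2_inner M2 (T u) v = l2_inner M1 u (S v))"

definition symmetric_pair ::
  "'a measure \<Rightarrow> ('a \<Rightarrow> real) set \<Rightarrow> ('a \<Rightarrow> real) set \<Rightarrow>
   'b measure \<Rightarrow> ('b \<Rightarrow> real) set \<Rightarrow> ('b \<Rightarrow> real) set \<Rightarrow>
   (('a \<Rightarrow> real) \<Rightarrow> 'b \<Rightarrow> real) \<Rightarrow> (('b \<Rightarrow> real) \<Rightarrow> 'a \<Rightarrow> real) \<Rightarrow> bool" where
  "symmetric_pair M1 H1 D1 M2 H2 D2 T S \<longleftrightarrow>
     l2_dense_subspace M1 H1 D1 \<and> l2_dense_subspace M2 H2 D2 \<and>
     formally_adjoint M1 H1 D1 M2 H2 D2 T S"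

definition is_l2_proj ::
  "'a measure \<Rightarrow> ('a \<Rightarrow> real) set \<Rightarrow> ('a \<Rightarrow> real) \<Rightarrow> ('a \<Rightarrow> real) \<Rightarrow> bool" where
  "is_l2_proj M H g p \<longleftrightarrow> p \<in> H \<and> (\<forall>h\<in>H. l2_inner M h (\<lambda>x. g x - p x) = 0)"

definition nonatomic :: "'a measure \<Rightarrow> bool" where
  "nonatomic M \<longleftrightarrow>
     (\<forall>A\<in>sets M. 0 < emeasure M A \<longrightarrow>
        (\<exists>B\<in>sets M. B \<subseteq> A \<and> 0 < emeasure M B \<and> emeasure M B < emeasure M A))"

definition lamJ :: "real measure" where
  "lamJ = restrict_space lborel {0..1}"

(* Functions on J are functions on the real line whose values off [0,1] are irrelevant; test
   functions are extended by 0. The support is automatically compact, being closed and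
   bounded. *)
definition test_functions :: "(real \<Rightarrow> real) set" where
  "test_functions =
     {\<phi>. (\<forall>n. (deriv ^^ n) \<phi> differentiable_on UNIV) \<and>
          closure {x. \<phi> x \<noteq> 0} \<subseteq> interior {0..1}}"

(* Integrability is part of the definition: if M is infinite, a function in L2(M) need not be
   integrable, and the integrals below would default to 0. *)
definition has_mu_deriv :: "real measure \<Rightarrow> (real \<Rightarrow> real) \<Rightarrow> (real \<Rightarrow> real) \<Rightarrow> bool" where
  "has_mu_deriv M f g \<longleftrightarrow>
     g \<in> L2 M \<and>
     (\<forall>x\<in>{0..1}. set_integrable M {0..x} g \<and>
                  f x = f 0 + set_lebesgue_integral M {0..x} g)"

definition dom_T :: "real measure \<Rightarrow> (real \<Rightarrow> real) set" where
  "dom_T M = {f. \<exists>g. has_mu_deriv M f g}"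

definition T_mu :: "real measure \<Rightarrow> (real \<Rightarrow> real) \<Rightarrow> real \<Rightarrow> real" where
  "T_mu M f = (SOME g. has_mu_deriv M f g)"

definition scrL2 :: "real measure \<Rightarrow> (real \<Rightarrow> real) set" where
  "scrL2 M = l2_closure lamJ (dom_T M)"

(* -d/dx as an operator into the closed subspace scrL2 M of L2(lamJ): the element of scrL2 M
   with the same inner products against scrL2 M as -phi'. It is -phi' itself (a.e.) whenever
   -phi' lies in scrL2 M. The derivative can fall outside: if M lives on the Cantor set, all
   elements of scrL2 M are constant on each gap. In that case the class of phi in L2(M) does
   not determine phi' a.e., but it does determine this projection. *)
definition D_op :: "real measure \<Rightarrow> (real \<Rightarrow> real) \<Rightarrow> real \<Rightarrow> real" where
  "D_op M \<phi> = (SOME p. is_l2_proj lamJ (scrL2 M) (\<lambda>x. - deriv \<phi> x) p)"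

end

theory Submission
  imports Defs
begin

text \<open>If \<open>f\<close> is a primitive of \<open>g\<close> with respect to \<open>\<mu>\<close>, then Fubini's theorem on the triangle
  \<open>y \<le> x\<close> gives
  \<open>\<integral> \<phi>' f dx = f 0 \<integral> \<phi>' dx + \<integral> g y (\<integral>\<^sub>[\<^sub>y\<^sub>,\<^sub>1\<^sub>] \<phi>' dx) d\<mu> y = - \<integral> \<phi> g d\<mu>\<close>,
  because \<open>\<phi>\<close> vanishes at \<open>0\<close> and \<open>1\<close> (lemma \<open>integration_by_parts\<close>). Everything else is needed
  to turn this identity into a statement about operators on spaces of classes.

  The operator \<open>T\<close> is well defined on classes because \<open>\<mu>\<close> has no atoms: primitives are then
  continuous, so those that agree Lebesgue-almost everywhere agree on \<open>[0,1]\<close>, and a primitive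
  determines its density \<open>\<mu>\<close>-almost everywhere by a \<open>\<pi>\<close>-\<open>\<lambda>\<close> argument (\<open>has_mu_deriv_AE_eq\<close>).

  The operator \<open>D\<close> takes \<open>\<phi>\<close> to the orthogonal projection of \<open>- \<phi>'\<close> onto the closure of the
  domain of \<open>T\<close>. Existence of projections is the completeness of \<open>L\<^sup>2\<close>, proved by the
  Riesz--Fischer argument (\<open>l2_projection_exists\<close>). Projecting does not affect inner products with
  the domain of \<open>T\<close>, so \<open>T\<close> and \<open>D\<close> are formally adjoint, and density of that domain then shows
  that \<open>D \<phi>\<close> depends only on the class of \<open>\<phi>\<close> in \<open>L\<^sup>2(\<mu>)\<close> (\<open>D_op_cong_AE\<close>).

  If all test functions are in \<open>L\<^sup>2(\<mu>)\<close>, they are dense: bumps built from \<open>exp (- 1 / x)\<close> converge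
  to indicators of intervals, so a function orthogonal to all test functions has integral
  zero over every \<open>(a,b)\<close> with \<open>0 < a < b < 1\<close>, hence is zero almost everywhere
  (\<open>AE_eq_0_of_orthogonal_test_functions\<close>).\<close>

section \<open>Square integrable functions and orthogonal projections\<close>

lemma L2_iff: "f \<in> L2 M \<longleftrightarrow> f \<in> borel_measurable M \<and> integrable M (\<lambda>x. (f x)\<^sup>2)"
  by (simp add: L2_def)

lemma L2_mult_integrable:
  assumes "u \<in> L2 M" "v \<in> L2 M"
  shows "integrable M (\<lambda>x. u x * v x)"
proof (rule Bochner_Integration.integrable_bound)
  show "integrable M (\<lambda>x. (u x)\<^sup>2 + (v x)\<^sup>2)"
    using assms by (auto simp: L2_iff)
  have "\<bar>a * b\<bar> \<le> a\<^sup>2 + b\<^sup>2" for a b :: real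
  proof -
    have "2 * \<bar>a * b\<bar> \<le> a\<^sup>2 + b\<^sup>2"
      using sum_squares_bound[of "\<bar>a\<bar>" "\<bar>b\<bar>"] by (simp add: abs_mult)
    then show ?thesis using abs_ge_zero[of "a * b"] by linarith
  qed
  then show "AE x in M. norm (u x * v x) \<le> norm ((u x)\<^sup>2 + (v x)\<^sup>2)"
    by auto
qed (use assms in \<open>auto simp: L2_iff\<close>)

lemma L2_lincomb:
  assumes "u \<in> L2 M" "v \<in> L2 M"
  shows "(\<lambda>x. a * u x + b * v x) \<in> L2 M"
proof -
  have "(\<lambda>x. (a * u x + b * v x)\<^sup>2)
      = (\<lambda>x. a\<^sup>2 * (u x)\<^sup>2 + b\<^sup>2 * (v x)\<^sup>2 + 2 * a * b * (u x * v x))"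
    by (auto simp: power2_eq_square algebra_simps)
  then show ?thesis
    using assms L2_mult_integrable[OF assms] by (auto simp: L2_iff)
qed

lemma L2_diff: "u \<in> L2 M \<Longrightarrow> v \<in> L2 M \<Longrightarrow> (\<lambda>x. u x - v x) \<in> L2 M"
  using L2_lincomb[of u M v 1 "-1"] by simp

lemma L2_zero: "(\<lambda>x. 0) \<in> L2 M"
  by (simp add: L2_iff)

lemma fun_subspace_L2: "fun_subspace (L2 M)"
  by (auto simp: fun_subspace_def L2_zero L2_lincomb)

lemma l2_inner_lincomb_left:
  assumes "u \<in> L2 M" "v \<in> L2 M" "w \<in> L2 M"
  shows "l2_inner M (\<lambda>x. a * u x + b * v x) w = a * l2_inner M u w + b * l2_inner M v w"
proof -
  have "(\<lambda>x. (a * u x + b * v x) * w x) = (\<lambda>x. a * (u x * w x) + b * (v x * w x))"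
    by (auto simp: algebra_simps)
  then show ?thesis
    using L2_mult_integrable[OF assms(1,3)] L2_mult_integrable[OF assms(2,3)]
    by (simp add: l2_inner_def)
qed

lemma l2_inner_commute: "l2_inner M u v = l2_inner M v u"
  by (simp add: l2_inner_def mult.commute)

lemma l2_inner_lincomb_right:
  assumes "u \<in> L2 M" "v \<in> L2 M" "w \<in> L2 M"
  shows "l2_inner M w (\<lambda>x. a * u x + b * v x) = a * l2_inner M w u + b * l2_inner M w v"
  using l2_inner_lincomb_left[OF assms] by (simp add: l2_inner_commute)

lemma l2_inner_diff_right:
  assumes "u \<in> L2 M" "v \<in> L2 M" "w \<in> L2 M"
  shows "l2_inner M w (\<lambda>x. u x - v x) = l2_inner M w u - l2_inner M w v"
  using l2_inner_lincomb_right[OF assms, of 1 "-1"] by simp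

lemma l2_inner_self_nonneg: "0 \<le> l2_inner M u u"
  by (simp add: l2_inner_def)

lemma l2_inner_self_eq_0_AE:
  assumes "u \<in> L2 M" "l2_inner M u u = 0"
  shows "AE x in M. u x = 0"
proof -
  have "(\<integral>x. (u x)\<^sup>2 \<partial>M) = 0" "integrable M (\<lambda>x. (u x)\<^sup>2)"
    using assms by (auto simp: l2_inner_def L2_iff power2_eq_square)
  then show ?thesis
    by (simp add: integral_nonneg_eq_0_iff_AE)
qed

text \<open>Working with squared distances replaces the triangle inequality by the pointwise
  inequality \<open>(a + b)\<^sup>2 \<le> 2 a\<^sup>2 + 2 b\<^sup>2\<close>.\<close>

lemma l2_closure_iff:
  "g \<in> l2_closure M A \<longleftrightarrow>
     g \<in> L2 M \<and> (\<forall>e>0. \<exists>f\<in>A. l2_inner M (\<lambda>x. f x - g x) (\<lambda>x. f x - g x) < e)"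
proof -
  have "(\<forall>e>0. \<exists>f\<in>A. l2_norm M (\<lambda>x. f x - g x) < e) \<longleftrightarrow>
        (\<forall>e>0. \<exists>f\<in>A. l2_inner M (\<lambda>x. f x - g x) (\<lambda>x. f x - g x) < e)"
    (is "?L \<longleftrightarrow> ?R")
  proof
    assume L: ?L
    show ?R
    proof (intro allI impI)
      fix e :: real assume "e > 0"
      then obtain f where "f \<in> A" "l2_norm M (\<lambda>x. f x - g x) < sqrt e"
        using L by (meson real_sqrt_gt_zero)
      then show "\<exists>f\<in>A. l2_inner M (\<lambda>x. f x - g x) (\<lambda>x. f x - g x) < e"
        by (auto simp: l2_norm_def)
    qed
  next
    assume R: ?R
    show ?L
    proof (intro allI impI)
      fix e :: real assume e: "e > 0"
      then have "e\<^sup>2 > 0" by simp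
      then obtain f where f: "f \<in> A" "l2_inner M (\<lambda>x. f x - g x) (\<lambda>x. f x - g x) < e\<^sup>2"
        using R by blast
      have "l2_norm M (\<lambda>x. f x - g x) < e"
        unfolding l2_norm_def using f(2) e by (intro real_less_lsqrt) auto
      then show "\<exists>f\<in>A. l2_norm M (\<lambda>x. f x - g x) < e"
        using f by blast
    qed
  qed
  then show ?thesis by (simp add: l2_closure_def)
qed

lemma l2_closure_subset_L2: "l2_closure M A \<subseteq> L2 M"
  by (auto simp: l2_closure_iff)

lemma subset_l2_closure:
  assumes "A \<subseteq> L2 M" shows "A \<subseteq> l2_closure M A"
proof
  fix f assume "f \<in> A"
  then show "f \<in> l2_closure M A"
    using assms by (auto simp: l2_closure_iff l2_inner_def intro!: bexI[of _ f])
qed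

lemma l2_inner_self_lincomb_le:
  assumes "u \<in> L2 M" "v \<in> L2 M"
  shows "l2_inner M (\<lambda>x. a * u x + b * v x) (\<lambda>x. a * u x + b * v x)
       \<le> 2 * a\<^sup>2 * l2_inner M u u + 2 * b\<^sup>2 * l2_inner M v v"
proof -
  have int: "integrable M (\<lambda>x. u x * u x)" "integrable M (\<lambda>x. v x * v x)"
    using L2_mult_integrable assms by auto
  have pt: "(a * s + b * t) * (a * s + b * t) \<le> 2 * a\<^sup>2 * (s * s) + 2 * b\<^sup>2 * (t * t)" for s t
    using zero_le_power2[of "a * s - b * t"] by (simp add: power2_eq_square algebra_simps)
  have "l2_inner M (\<lambda>x. a * u x + b * v x) (\<lambda>x. a * u x + b * v x)
      \<le> (\<integral>x. 2 * a\<^sup>2 * (u x * u x) + 2 * b\<^sup>2 * (v x * v x) \<partial>M)"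
    unfolding l2_inner_def
    by (intro integral_mono L2_mult_integrable L2_lincomb assms pt) (use int in auto)
  then show ?thesis using int by (simp add: l2_inner_def)
qed

lemma l2_closure_idem:
  assumes "A \<subseteq> L2 M"
  shows "l2_closure M (l2_closure M A) = l2_closure M A"
proof
  show "l2_closure M A \<subseteq> l2_closure M (l2_closure M A)"
    by (intro subset_l2_closure l2_closure_subset_L2)
  show "l2_closure M (l2_closure M A) \<subseteq> l2_closure M A"
  proof
    fix g assume g: "g \<in> l2_closure M (l2_closure M A)"
    have gL: "g \<in> L2 M" using g by (simp add: l2_closure_iff)
    have "\<exists>f\<in>A. l2_inner M (\<lambda>x. f x - g x) (\<lambda>x. f x - g x) < e" if "e > 0" for e
    proof -
      obtain h where h: "h \<in> l2_closure M A"
          "l2_inner M (\<lambda>x. h x - g x) (\<lambda>x. h x - g x) < e / 4"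
        using g \<open>e > 0\<close> by (auto simp: l2_closure_iff dest!: spec[of _ "e/4"])
      then have hL: "h \<in> L2 M" by (simp add: l2_closure_iff)
      obtain f where f: "f \<in> A" "l2_inner M (\<lambda>x. f x - h x) (\<lambda>x. f x - h x) < e / 4"
        using h \<open>e > 0\<close> by (auto simp: l2_closure_iff dest!: spec[of _ "e/4"])
      then have fL: "f \<in> L2 M" using assms by auto
      have "l2_inner M (\<lambda>x. f x - g x) (\<lambda>x. f x - g x) < e"
        using l2_inner_self_lincomb_le[OF L2_diff[OF fL hL] L2_diff[OF hL gL], of 1 1] f h
        by simp
      then show ?thesis using f by blast
    qed
    then show "g \<in> l2_closure M A" using gL by (simp add: l2_closure_iff)
  qed
qed

lemma fun_subspace_l2_closure:
  assumes "A \<subseteq> L2 M" "fun_subspace A"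
  shows "fun_subspace (l2_closure M A)"
  unfolding fun_subspace_def
proof (intro conjI ballI allI)
  show "(\<lambda>x. 0) \<in> l2_closure M A"
    using subset_l2_closure[OF assms(1)] assms(2) by (auto simp: fun_subspace_def)
next
  fix u v :: "'a \<Rightarrow> real" and a b :: real
  assume u: "u \<in> l2_closure M A" and v: "v \<in> l2_closure M A"
  have L: "u \<in> L2 M" "v \<in> L2 M" using u v by (auto simp: l2_closure_iff)
  define K where "K = 2 * a\<^sup>2 + 2 * b\<^sup>2 + 1"
  have K: "K > 0" unfolding K_def by (simp add: add_nonneg_pos)
  have "\<exists>f\<in>A. l2_inner M (\<lambda>x. f x - (a * u x + b * v x)) (\<lambda>x. f x - (a * u x + b * v x)) < e"
    if "e > 0" for e
  proof -
    have eK: "e / K > 0" using that K by simp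
    obtain f where f: "f \<in> A" "l2_inner M (\<lambda>x. f x - u x) (\<lambda>x. f x - u x) < e / K"
      using u eK unfolding l2_closure_iff by blast
    obtain g where g: "g \<in> A" "l2_inner M (\<lambda>x. g x - v x) (\<lambda>x. g x - v x) < e / K"
      using v eK unfolding l2_closure_iff by blast
    have fg: "f \<in> L2 M" "g \<in> L2 M" using f g assms by auto
    have eq: "(\<lambda>x. (a * f x + b * g x) - (a * u x + b * v x))
        = (\<lambda>x. a * (f x - u x) + b * (g x - v x))"
      by (auto simp: algebra_simps)
    have "l2_inner M (\<lambda>x. (a * f x + b * g x) - (a * u x + b * v x))
            (\<lambda>x. (a * f x + b * g x) - (a * u x + b * v x))
        \<le> 2 * a\<^sup>2 * l2_inner M (\<lambda>x. f x - u x) (\<lambda>x. f x - u x)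
          + 2 * b\<^sup>2 * l2_inner M (\<lambda>x. g x - v x) (\<lambda>x. g x - v x)"
      unfolding eq using L fg by (intro l2_inner_self_lincomb_le L2_diff)
    also have "\<dots> \<le> 2 * a\<^sup>2 * (e / K) + 2 * b\<^sup>2 * (e / K)"
      using f g by (intro add_mono mult_left_mono) auto
    also have "\<dots> = e * ((2 * a\<^sup>2 + 2 * b\<^sup>2) / K)"
      by (simp add: add_divide_distrib algebra_simps)
    also have "\<dots> < e * 1"
      using that K by (intro mult_strict_left_mono) (auto simp: K_def field_simps)
    finally show ?thesis
      using assms(2) f g by (auto simp: fun_subspace_def intro!: bexI[of _ "\<lambda>x. a * f x + b * g x"])
  qed
  then show "(\<lambda>x. a * u x + b * v x) \<in> l2_closure M A"
    using L2_lincomb[OF L] by (simp add: l2_closure_iff)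
qed

text \<open>Continuity of the inner product, in the only form that is used: by
  \<open>2 \<bar>s t\<bar> \<le> s\<^sup>2 / c + c t\<^sup>2\<close>, applied to \<open>s = h - f\<close> with \<open>f\<close> close to \<open>h\<close>.\<close>

lemma l2_inner_eq_0_closure:
  assumes A: "A \<subseteq> L2 M" and k: "k \<in> L2 M"
    and 0: "\<And>f. f \<in> A \<Longrightarrow> l2_inner M f k = 0"
    and h: "h \<in> l2_closure M A"
  shows "l2_inner M h k = 0"
proof -
  have hL: "h \<in> L2 M" using h by (simp add: l2_closure_iff)
  \<comment> \<open>Adding \<open>1\<close> keeps the divisor positive when \<open>k\<close> vanishes almost everywhere.\<close>
  define K where "K = l2_inner M k k + 1"
  have K: "K > 0" using l2_inner_self_nonneg[of M k] by (simp add: K_def)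
  have "\<bar>l2_inner M h k\<bar> \<le> e" if e: "e > 0" for e
  proof -
    define c where "c = e / K"
    have c: "c > 0" using e K by (simp add: c_def)
    obtain f where f: "f \<in> A" "l2_inner M (\<lambda>x. f x - h x) (\<lambda>x. f x - h x) < c * e"
      using h e c by (auto simp: l2_closure_iff dest!: spec[of _ "c * e"])
    have fL: "f \<in> L2 M" using f A by auto
    have d: "(\<lambda>x. f x - h x) \<in> L2 M" using L2_diff fL hL by auto
    have pt: "\<bar>s * t\<bar> \<le> (1/2) * (1 / c * (s * s)) + (1/2) * (c * (t * t))" for s t :: real
    proof -
      have "0 \<le> (1 / c) * (\<bar>s\<bar> - c * \<bar>t\<bar>)\<^sup>2" using c by simp
      also have "\<dots> = 1 / c * (s * s) - 2 * \<bar>s * t\<bar> + c * (t * t)"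
        using c by (simp add: power2_eq_square field_simps abs_mult)
      finally show ?thesis by simp
    qed
    have "\<bar>l2_inner M (\<lambda>x. f x - h x) k\<bar> \<le> (\<integral>x. \<bar>(f x - h x) * k x\<bar> \<partial>M)"
      unfolding l2_inner_def by (rule integral_abs_bound)
    also have "\<dots> \<le> (\<integral>x. (1/2) * (1 / c * ((f x - h x) * (f x - h x)))
                        + (1/2) * (c * (k x * k x)) \<partial>M)"
      using L2_mult_integrable[OF d k] L2_mult_integrable[OF d d] L2_mult_integrable[OF k k]
      by (intro integral_mono pt) auto
    also have "\<dots> = (1/2) * (1 / c * l2_inner M (\<lambda>x. f x - h x) (\<lambda>x. f x - h x))
                  + (1/2) * (c * l2_inner M k k)"
      using L2_mult_integrable[OF d d] L2_mult_integrable[OF k k] by (simp add: l2_inner_def)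
    also have "\<dots> \<le> (1/2) * e + (1/2) * e"
    proof (intro add_mono mult_left_mono)
      show "1 / c * l2_inner M (\<lambda>x. f x - h x) (\<lambda>x. f x - h x) \<le> e"
        using f c by (simp add: field_simps)
      show "c * l2_inner M k k \<le> e"
        using K e by (simp add: c_def K_def field_simps)
    qed auto
    finally have "\<bar>l2_inner M (\<lambda>x. f x - h x) k\<bar> \<le> e" by simp
    moreover have "l2_inner M (\<lambda>x. f x - h x) k = - l2_inner M h k"
      using l2_inner_diff_right[OF fL hL k] 0[OF f(1)] by (simp add: l2_inner_commute)
    ultimately show ?thesis by simp
  qed
  then have "\<bar>l2_inner M h k\<bar> \<le> 0" by (rule field_le_epsilon) auto
  then show ?thesis by simp
qed

lemma l2_hilbert_closure:
  assumes "A \<subseteq> L2 M" "fun_subspace A"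
  shows "l2_hilbert M (l2_closure M A)"
  using assms by (simp add: l2_hilbert_def l2_closure_subset_L2 fun_subspace_l2_closure l2_closure_idem)

lemma l2_hilbert_L2: "l2_hilbert M (L2 M)"
  unfolding l2_hilbert_def
  using subset_l2_closure[of "L2 M" M] l2_closure_subset_L2[of M "L2 M"] fun_subspace_L2 by auto

text \<open>Fatou's lemma for squares. The bound depends on \<open>n\<close> so that a minimising sequence
  yields the sharp bound for its limit.\<close>

lemma L2_limit_bound:
  assumes f: "\<And>n. f n \<in> L2 M" and g[measurable]: "g \<in> borel_measurable M"
    and lim: "AE x in M. (\<lambda>n. f n x) \<longlonglongrightarrow> g x"
    and bound: "\<And>n. l2_inner M (f n) (f n) \<le> c n" and c: "c \<longlonglongrightarrow> C"
  shows "g \<in> L2 M" "l2_inner M g g \<le> C"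
proof -
  have [measurable]: "f n \<in> borel_measurable M" for n using f by (simp add: L2_iff)
  have C: "C \<ge> 0"
    using c by (rule LIMSEQ_le_const) (use bound l2_inner_self_nonneg order_trans in blast)
  have "(\<integral>\<^sup>+x. ennreal ((g x)\<^sup>2) \<partial>M) = (\<integral>\<^sup>+x. liminf (\<lambda>n. ennreal ((f n x)\<^sup>2)) \<partial>M)"
  proof (rule nn_integral_cong_AE)
    show "AE x in M. ennreal ((g x)\<^sup>2) = liminf (\<lambda>n. ennreal ((f n x)\<^sup>2))"
      using lim
    proof eventually_elim
      case (elim x)
      then have "(\<lambda>n. ennreal ((f n x)\<^sup>2)) \<longlonglongrightarrow> ennreal ((g x)\<^sup>2)"
        by (intro tendsto_ennrealI tendsto_power)
      then show ?case by (intro lim_imp_Liminf[symmetric]) auto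
    qed
  qed
  also have "\<dots> \<le> liminf (\<lambda>n. \<integral>\<^sup>+x. ennreal ((f n x)\<^sup>2) \<partial>M)"
    by (rule nn_integral_liminf) measurable
  also have "\<dots> \<le> liminf (\<lambda>n. ennreal (c n))"
  proof (rule Liminf_mono, rule always_eventually, rule allI)
    fix n
    have "(\<integral>\<^sup>+x. ennreal ((f n x)\<^sup>2) \<partial>M) = ennreal (\<integral>x. (f n x)\<^sup>2 \<partial>M)"
      using f by (intro nn_integral_eq_integral) (auto simp: L2_iff)
    then show "(\<integral>\<^sup>+x. ennreal ((f n x)\<^sup>2) \<partial>M) \<le> ennreal (c n)"
      using bound[of n] by (simp add: l2_inner_def power2_eq_square ennreal_leI)
  qed
  also have "\<dots> = ennreal C"
    using tendsto_ennrealI[OF c] by (intro lim_imp_Liminf) auto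
  finally have le: "(\<integral>\<^sup>+x. ennreal ((g x)\<^sup>2) \<partial>M) \<le> ennreal C" .
  have int: "integrable M (\<lambda>x. (g x)\<^sup>2)"
  proof (rule integrableI_bounded)
    show "(\<integral>\<^sup>+x. ennreal (norm ((g x)\<^sup>2)) \<partial>M) < \<infinity>"
      using le_less_trans[OF le] by simp
  qed simp
  then show "g \<in> L2 M" by (simp add: L2_iff)
  have "ennreal (\<integral>x. (g x)\<^sup>2 \<partial>M) \<le> ennreal C"
    using le nn_integral_eq_integral[OF int] by simp
  then show "l2_inner M g g \<le> C"
    using C by (simp add: l2_inner_def power2_eq_square)
qed

text \<open>The Riesz--Fischer step, on an arbitrary measure space. The bounds make
  \<open>\<Sum>n. 2\<^sup>n (d n)\<^sup>2\<close> integrable, hence finite almost everywhere, and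
  \<open>\<bar>d n\<bar> \<le> 2\<^sup>-\<^sup>n + 2\<^sup>n (d n)\<^sup>2\<close>.\<close>

lemma AE_summable_of_L2_bound:
  assumes d: "\<And>n. d n \<in> L2 M" and bound: "\<And>n. l2_inner M (d n) (d n) \<le> K * (1/8) ^ n"
  shows "AE x in M. summable (\<lambda>n. d n x)"
proof -
  have [measurable]: "d n \<in> borel_measurable M" for n using d by (simp add: L2_iff)
  have K: "K \<ge> 0" using bound[of 0] l2_inner_self_nonneg[of M "d 0"] by simp
  have "(\<integral>\<^sup>+x. (\<Sum>n. ennreal (2 ^ n * (d n x)\<^sup>2)) \<partial>M)
      = (\<Sum>n. \<integral>\<^sup>+x. ennreal (2 ^ n * (d n x)\<^sup>2) \<partial>M)"
    by (rule nn_integral_suminf) measurable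
  also have "\<dots> \<le> (\<Sum>n. ennreal (K * (1/4) ^ n))"
  proof (rule suminf_le)
    fix n
    have "(\<integral>\<^sup>+x. ennreal (2 ^ n * (d n x)\<^sup>2) \<partial>M) = ennreal (\<integral>x. 2 ^ n * (d n x)\<^sup>2 \<partial>M)"
      using d by (intro nn_integral_eq_integral) (auto simp: L2_iff)
    also have "(\<integral>x. 2 ^ n * (d n x)\<^sup>2 \<partial>M) = 2 ^ n * l2_inner M (d n) (d n)"
      by (simp add: l2_inner_def power2_eq_square)
    also have "\<dots> \<le> 2 ^ n * (K * (1/8) ^ n)"
      using bound by (intro mult_left_mono) auto
    also have "\<dots> = K * (1/4) ^ n"
      using power_mult_distrib[of "2 :: real" "1/8" n] by simp
    finally show "(\<integral>\<^sup>+x. ennreal (2 ^ n * (d n x)\<^sup>2) \<partial>M) \<le> ennreal (K * (1/4) ^ n)"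
      by (simp add: ennreal_leI)
  qed auto
  also have "\<dots> < \<infinity>"
  proof -
    have "summable (\<lambda>n. K * (1/4 :: real) ^ n)"
      by (intro summable_mult summable_geometric) simp
    then show ?thesis
      using K by (simp add: suminf_ennreal2 less_top)
  qed
  finally have fin: "(\<integral>\<^sup>+x. (\<Sum>n. ennreal (2 ^ n * (d n x)\<^sup>2)) \<partial>M) \<noteq> \<infinity>" by simp
  have "AE x in M. (\<Sum>n. ennreal (2 ^ n * (d n x)\<^sup>2)) \<noteq> \<infinity>"
    by (rule nn_integral_PInf_AE[OF _ fin]) measurable
  then show ?thesis
  proof eventually_elim
    case (elim x)
    have "summable (\<lambda>n. 2 ^ n * (d n x)\<^sup>2)"
      using elim by (intro summable_suminf_not_top) auto
    then have s: "summable (\<lambda>n. (1/2) ^ n + 2 ^ n * (d n x)\<^sup>2)"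
      by (intro summable_add summable_geometric) simp
    have "norm (d n x) \<le> (1/2) ^ n + 2 ^ n * (d n x)\<^sup>2" for n
    proof -
      have pos: "(2::real) ^ n > 0" by simp
      have "0 \<le> (1/2) ^ n * (1 - 2 ^ n * \<bar>d n x\<bar>)\<^sup>2" by simp
      also have "\<dots> = (1/2) ^ n + 2 ^ n * (d n x)\<^sup>2 - 2 * \<bar>d n x\<bar>"
        using pos by (simp add: power2_eq_square field_simps power_divide)
      finally show ?thesis by simp
    qed
    then show ?case using s summable_comparison_test'[of _ 0 "\<lambda>n. d n x"] by blast
  qed
qed

text \<open>The projection onto a closed subspace minimises the distance. The parallelogram
  law makes a minimising sequence \<open>h\<close> Cauchy; choosing its squared distances within
  \<open>8\<^sup>-\<^sup>n\<close> of their infimum gives almost everywhere convergence, and Fatou's lemma transfers the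
  estimates to the limit. Perturbing the minimiser gives orthogonality.\<close>

lemma l2_projection_exists:
  assumes H: "l2_hilbert M H" and g: "g \<in> L2 M"
  shows "\<exists>p. is_l2_proj M H g p"
proof -
  have HL: "H \<subseteq> L2 M" and sub: "fun_subspace H" and cl: "l2_closure M H = H"
    using H by (auto simp: l2_hilbert_def)
  have lin: "(\<lambda>x. a * u x + b * v x) \<in> H" if "u \<in> H" "v \<in> H" for a b u v
    using sub that by (auto simp: fun_subspace_def)
  define Q where "Q f = l2_inner M f f" for f :: "'a \<Rightarrow> real"
  define \<delta> where "\<delta> = Inf ((\<lambda>h. Q (\<lambda>x. g x - h x)) ` H)"
  have Q0: "0 \<le> Q f" for f by (simp add: Q_def l2_inner_self_nonneg)
  have ne: "H \<noteq> {}" using sub by (auto simp: fun_subspace_def)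
  have bdd: "bdd_below ((\<lambda>h. Q (\<lambda>x. g x - h x)) ` H)"
    using Q0 by (intro bdd_belowI[of _ 0]) auto
  have \<delta>_le: "\<delta> \<le> Q (\<lambda>x. g x - h x)" if "h \<in> H" for h
    unfolding \<delta>_def using that bdd by (intro cInf_lower) auto
  have "\<exists>h\<in>H. Q (\<lambda>x. g x - h x) < \<delta> + (1/8) ^ n" for n :: nat
  proof -
    have "Inf ((\<lambda>h. Q (\<lambda>x. g x - h x)) ` H) < \<delta> + (1/8) ^ n"
      by (simp add: \<delta>_def)
    then show ?thesis using cInf_lessD[of "(\<lambda>h. Q (\<lambda>x. g x - h x)) ` H"] ne by auto
  qed
  then obtain h where hH: "\<And>n. h n \<in> H"
      and hQ: "\<And>n. Q (\<lambda>x. g x - h n x) < \<delta> + (1/8) ^ n" by metis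
  have hL: "h n \<in> L2 M" for n using hH HL by auto
  have [measurable]: "h n \<in> borel_measurable M" for n using hL by (simp add: L2_iff)
  have [measurable]: "g \<in> borel_measurable M" using g by (simp add: L2_iff)
  have cauchy: "Q (\<lambda>x. h m x - h n x) \<le> 2 * (1/8) ^ m + 2 * (1/8) ^ n" for m n
  proof -
    let ?u = "\<lambda>x. g x - h m x" and ?v = "\<lambda>x. g x - h n x"
    let ?w = "\<lambda>x. g x - ((1/2) * h m x + (1/2) * h n x)"
    have wL: "?w \<in> L2 M" using L2_diff[OF g L2_lincomb[OF hL hL]] .
    have int: "integrable M (\<lambda>x. ?u x * ?u x)" "integrable M (\<lambda>x. ?v x * ?v x)"
        "integrable M (\<lambda>x. ?w x * ?w x)"
      using L2_mult_integrable L2_diff g hL wL by blast+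
    have "(\<lambda>x. (h m x - h n x) * (h m x - h n x))
        = (\<lambda>x. 2 * (?u x * ?u x) + 2 * (?v x * ?v x) - 4 * (?w x * ?w x))"
      by (auto simp: field_simps)
    then have "Q (\<lambda>x. h m x - h n x) = 2 * Q ?u + 2 * Q ?v - 4 * Q ?w"
      using int by (simp add: Q_def l2_inner_def)
    also have "\<dots> \<le> 2 * (\<delta> + (1/8) ^ m) + 2 * (\<delta> + (1/8) ^ n) - 4 * \<delta>"
      using hQ[of m] hQ[of n] \<delta>_le[OF lin[OF hH hH], of "1/2" m "1/2" n] by argo
    finally show ?thesis by simp
  qed
  have "AE x in M. summable (\<lambda>n. h (Suc n) x - h n x)"
  proof (rule AE_summable_of_L2_bound)
    show "l2_inner M (\<lambda>x. h (Suc n) x - h n x) (\<lambda>x. h (Suc n) x - h n x) \<le> 4 * (1/8) ^ n" for n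
      using cauchy[of "Suc n" n] zero_le_power[of "1/8 :: real" n]
      unfolding Q_def power_Suc by linarith
  qed (use L2_diff hL in auto)
  then have conv: "AE x in M. convergent (\<lambda>n. h n x)"
  proof eventually_elim
    case (elim x)
    then obtain L where "(\<lambda>n. h n x - h 0 x) \<longlonglongrightarrow> L"
      by (auto simp: summable_iff_convergent sum_lessThan_telescope[of "\<lambda>n. h n x"] convergent_def)
    from tendsto_add[OF this tendsto_const[of "h 0 x"]] show ?case
      by (auto simp: convergent_def)
  qed
  define p where "p x = lim (\<lambda>n. h n x)" for x
  have [measurable]: "p \<in> borel_measurable M"
    unfolding p_def by measurable
  have limp: "AE x in M. (\<lambda>n. h n x) \<longlonglongrightarrow> p x"
    using conv by eventually_elim (auto simp: p_def convergent_LIMSEQ_iff)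
  have tail: "(\<lambda>x. p x - h n x) \<in> L2 M \<and> Q (\<lambda>x. p x - h n x) \<le> 2 * (1/8) ^ n" for n
  proof -
    have lim: "AE x in M. (\<lambda>m. h m x - h n x) \<longlonglongrightarrow> p x - h n x"
      using limp by eventually_elim (intro tendsto_intros)
    have c: "(\<lambda>m. 2 * (1/8) ^ m + 2 * (1/8) ^ n) \<longlonglongrightarrow> 2 * 0 + 2 * (1/8 :: real) ^ n"
      by (intro tendsto_intros LIMSEQ_power_zero) simp
    show ?thesis
      using L2_limit_bound[OF L2_diff[OF hL hL] _ lim cauchy[unfolded Q_def] c]
      by (simp add: Q_def)
  qed
  have pL: "p \<in> L2 M"
    using L2_lincomb[OF conjunct1[OF tail[of 0]] hL[of 0], of 1 1] by simp
  have pH: "p \<in> H"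
  proof -
    have "\<exists>f\<in>H. l2_inner M (\<lambda>x. f x - p x) (\<lambda>x. f x - p x) < e" if "e > 0" for e
    proof -
      have "\<exists>n. (1/8 :: real) ^ n < e / 2"
        by (rule real_arch_pow_inv) (use that in auto)
      then obtain n where n: "(1/8 :: real) ^ n < e / 2" ..
      have "l2_inner M (\<lambda>x. h n x - p x) (\<lambda>x. h n x - p x) = Q (\<lambda>x. p x - h n x)"
        by (simp add: Q_def l2_inner_def algebra_simps)
      also have "\<dots> < e" using tail[of n] n by linarith
      finally show ?thesis using hH by blast
    qed
    then have "p \<in> l2_closure M H" using pL by (simp add: l2_closure_iff)
    then show ?thesis using cl by simp
  qed
  have "Q (\<lambda>x. g x - p x) \<le> \<delta>"
  proof -
    have lim: "AE x in M. (\<lambda>m. g x - h m x) \<longlonglongrightarrow> g x - p x"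
      using limp by eventually_elim (intro tendsto_intros)
    have c: "(\<lambda>m. \<delta> + (1/8) ^ m) \<longlonglongrightarrow> \<delta> + 0"
      by (intro tendsto_intros LIMSEQ_power_zero) simp
    show ?thesis
      using L2_limit_bound(2)[OF L2_diff[OF g hL] _ lim less_imp_le[OF hQ[unfolded Q_def]] c]
      by (simp add: Q_def)
  qed
  have "l2_inner M k (\<lambda>x. g x - p x) = 0" if k: "k \<in> H" for k
  proof -
    have kL: "k \<in> L2 M" using k HL by auto
    have gpL: "(\<lambda>x. g x - p x) \<in> L2 M" using L2_diff g pL by auto
    define c where "c = l2_inner M k (\<lambda>x. g x - p x)"
    define N where "N = Q k + 1"
    have N: "N > 0" using Q0[of k] by (simp add: N_def)
    \<comment> \<open>The first-order term \<open>c\<close> of the squared distance along the line \<open>p + t k\<close> must vanish;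
      \<open>t = c / N\<close> stands in for the minimiser \<open>c / Q k\<close>, which is meaningless for \<open>Q k = 0\<close>.\<close>
    have quad: "0 \<le> t\<^sup>2 * Q k - 2 * t * c" for t
    proof -
      have eq: "(\<lambda>x. g x - (1 * p x + t * k x)) = (\<lambda>x. 1 * (g x - p x) + (- t) * k x)"
        by (auto simp: algebra_simps)
      have L: "(\<lambda>x. 1 * (g x - p x) + (- t) * k x) \<in> L2 M"
        using gpL kL by (rule L2_lincomb)
      have "\<delta> \<le> Q (\<lambda>x. 1 * (g x - p x) + (- t) * k x)"
        using \<delta>_le[OF lin[OF pH k, of 1 t]] unfolding eq .
      also have "\<dots> = Q (\<lambda>x. g x - p x) - 2 * t * c + t\<^sup>2 * Q k"
        unfolding Q_def l2_inner_lincomb_left[OF gpL kL L] l2_inner_lincomb_right[OF gpL kL gpL]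
          l2_inner_lincomb_right[OF gpL kL kL] c_def
        by (simp add: l2_inner_commute[of M "\<lambda>x. g x - p x" k] power2_eq_square algebra_simps)
      finally show ?thesis using \<open>Q (\<lambda>x. g x - p x) \<le> \<delta>\<close> by linarith
    qed
    have "0 \<le> (c / N)\<^sup>2 * Q k - 2 * (c / N) * c" by (rule quad)
    also have "\<dots> = (c / N)\<^sup>2 * (Q k - 2 * N)"
      using N by (simp add: power2_eq_square field_simps)
    finally have "0 \<le> (c / N)\<^sup>2 * (Q k - 2 * N)" .
    moreover have "Q k - 2 * N < 0" using Q0[of k] by (simp add: N_def)
    ultimately have "(c / N)\<^sup>2 \<le> 0" by (simp add: zero_le_mult_iff)
    then show ?thesis using N by (simp add: c_def)
  qed
  then have "is_l2_proj M H g p" using pH by (simp add: is_l2_proj_def)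
  then show ?thesis by blast
qed

lemma l2_proj_unique:
  assumes H: "l2_hilbert M H" and g: "g \<in> L2 M"
    and p: "is_l2_proj M H g p" and q: "is_l2_proj M H g q"
  shows "AE x in M. p x = q x"
proof -
  have pH: "p \<in> H" and qH: "q \<in> H" using p q by (auto simp: is_l2_proj_def)
  then have pL: "p \<in> L2 M" and qL: "q \<in> L2 M" using H by (auto simp: l2_hilbert_def)
  let ?d = "\<lambda>x. q x - p x"
  have dL: "?d \<in> L2 M" using L2_diff pL qL by auto
  have "(\<lambda>x. 1 * q x + (-1) * p x) \<in> H"
    using H pH qH unfolding l2_hilbert_def fun_subspace_def by blast
  then have dH: "?d \<in> H" by simp
  have "l2_inner M ?d (\<lambda>x. g x - p x) = 0" "l2_inner M ?d (\<lambda>x. g x - q x) = 0"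
    using p q dH by (auto simp: is_l2_proj_def)
  moreover have "l2_inner M ?d ?d = l2_inner M ?d (\<lambda>x. g x - p x) - l2_inner M ?d (\<lambda>x. g x - q x)"
    using l2_inner_diff_right[OF L2_diff[OF g pL] L2_diff[OF g qL] dL] by simp
  ultimately have "AE x in M. ?d x = 0"
    using l2_inner_self_eq_0_AE[OF dL] by simp
  then show ?thesis by eventually_elim simp
qed

lemma l2_proj_lincomb:
  assumes H: "l2_hilbert M H" and g: "g \<in> L2 M" "h \<in> L2 M"
    and p: "is_l2_proj M H g p" and q: "is_l2_proj M H h q"
  shows "is_l2_proj M H (\<lambda>x. a * g x + b * h x) (\<lambda>x. a * p x + b * q x)"
  unfolding is_l2_proj_def
proof (intro conjI ballI)
  have pH: "p \<in> H" and qH: "q \<in> H" using p q by (auto simp: is_l2_proj_def)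
  then show "(\<lambda>x. a * p x + b * q x) \<in> H"
    using H by (auto simp: l2_hilbert_def fun_subspace_def)
  fix k assume k: "k \<in> H"
  have L: "p \<in> L2 M" "q \<in> L2 M" "k \<in> L2 M" using H pH qH k by (auto simp: l2_hilbert_def)
  have eq: "(\<lambda>x. a * g x + b * h x - (a * p x + b * q x))
      = (\<lambda>x. a * (g x - p x) + b * (h x - q x))"
    by (auto simp: algebra_simps)
  show "l2_inner M k (\<lambda>x. a * g x + b * h x - (a * p x + b * q x)) = 0"
    unfolding eq using p q k
    by (simp add: l2_inner_lincomb_right[OF L2_diff[OF g(1) L(1)] L2_diff[OF g(2) L(2)] L(3)]
        is_l2_proj_def)
qed

section \<open>Primitives with respect to a non-atomic measure\<close>

lemma space_lamJ: "space lamJ = {0..1}"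
  by (simp add: lamJ_def space_restrict_space)

lemma sets_lamJ: "sets lamJ = sets (restrict_space borel {0..1})"
  unfolding lamJ_def by (rule sets_restrict_space_cong) simp

lemma finite_measure_lamJ: "finite_measure lamJ"
  by (rule finite_measureI) (simp add: lamJ_def space_restrict_space emeasure_restrict_space)

lemma continuous_on_imp_measurable:
  fixes f :: "real \<Rightarrow> real"
  assumes "sets M = sets (restrict_space borel {0..1})" "continuous_on {0..1} f"
  shows "f \<in> borel_measurable M"
  unfolding measurable_cong_sets[OF assms(1) refl]
  by (rule borel_measurable_continuous_on_restrict[OF assms(2)])

lemma continuous_on_unit_bounded:
  fixes f :: "real \<Rightarrow> real"
  assumes "continuous_on {0..1} f"
  obtains B where "\<And>x. x \<in> {0..1} \<Longrightarrow> \<bar>f x\<bar> \<le> B"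
proof -
  have "bounded (f ` {0..1})"
    using assms by (intro compact_imp_bounded compact_continuous_image) auto
  then obtain B where "\<forall>x\<in>{0..1}. \<bar>f x\<bar> \<le> B" by (auto simp: bounded_iff)
  then show ?thesis by (intro that) blast
qed

lemma continuous_on_integrable_lamJ:
  fixes f :: "real \<Rightarrow> real"
  assumes "continuous_on {0..1} f" shows "integrable lamJ f"
proof -
  obtain B where "\<And>x. x \<in> {0..1} \<Longrightarrow> \<bar>f x\<bar> \<le> B"
    using continuous_on_unit_bounded[OF assms] by blast
  then show ?thesis
    using finite_measure_lamJ continuous_on_imp_measurable[OF sets_lamJ assms]
    by (intro finite_measure.integrable_const_bound[of _ _ B]) (auto simp: space_lamJ)
qed

lemma continuous_on_L2_lamJ:
  fixes f :: "real \<Rightarrow> real"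
  assumes "continuous_on {0..1} f" shows "f \<in> L2 lamJ"
  unfolding L2_iff
  using continuous_on_imp_measurable[OF sets_lamJ assms]
    continuous_on_integrable_lamJ[OF continuous_on_power[OF assms]] by blast

lemma continuous_on_AE_eq_0:
  fixes w :: "real \<Rightarrow> real"
  assumes w: "continuous_on {0..1} w" and ae: "AE x in lamJ. w x = 0" and c: "c \<in> {0..1}"
  shows "w c = 0"
proof (rule ccontr)
  assume nz: "w c \<noteq> 0"
  obtain d where d: "d > 0" "\<And>x. x \<in> {0..1} \<Longrightarrow> dist x c < d \<Longrightarrow> dist (w x) (w c) < \<bar>w c\<bar>"
    using w c nz unfolding continuous_on_iff by (metis zero_less_abs_iff)
  define a b where "a = max 0 (c - d)" and "b = min 1 (c + d)"
  have ab: "a < b" using c d by (auto simp: a_def b_def)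
  have nz': "w x \<noteq> 0" if "x \<in> {a<..<b}" for x
  proof -
    have "x \<in> {0..1}" "dist x c < d" using that by (auto simp: a_def b_def dist_real_def abs_if)
    from d(2)[OF this] show ?thesis by (auto simp: dist_real_def)
  qed
  have "AE x in lborel. x \<in> {0..1} \<longrightarrow> w x = 0"
    using ae unfolding lamJ_def by (subst (asm) AE_restrict_space_iff) auto
  then have "AE x in lborel. x \<notin> {a<..<b}"
  proof eventually_elim
    case (elim x)
    then show ?case using nz'[of x] by (auto simp: a_def b_def)
  qed
  then have "{a<..<b} \<in> null_sets lborel"
    by (subst AE_iff_null_sets) auto
  then show False using ab by (auto simp: null_sets_def)
qed

locale nonatomic_unit_measure = sigma_finite_measure \<mu> for \<mu> :: "real measure" +
  assumes sets_\<mu>: "sets \<mu> = sets (restrict_space borel {0..1})"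
    and nonatomic_\<mu>: "nonatomic \<mu>"
begin

lemma space_\<mu>: "space \<mu> = {0..1}"
  using sets_eq_imp_space_eq[OF sets_\<mu>] by (simp add: space_restrict_space)

lemma borel_Int_in_sets: "B \<in> sets borel \<Longrightarrow> B \<inter> {0..1} \<in> sets \<mu>"
  by (auto simp: sets_\<mu> sets_restrict_space)

lemma interval_in_sets: "x \<le> 1 \<Longrightarrow> {0..x} \<in> sets \<mu>"
  using borel_Int_in_sets[of "{0..x}"] by (simp add: Int_absorb2)

lemma AE_neq: "AE y in \<mu>. y \<noteq> c"
proof (cases "c \<in> {0..1}")
  case True
  then have s: "{c} \<in> sets \<mu>" using borel_Int_in_sets[of "{c}"] by auto
  have "emeasure \<mu> {c} = 0"
  proof (rule ccontr)
    assume "emeasure \<mu> {c} \<noteq> 0"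
    then obtain B where "B \<subseteq> {c}" "0 < emeasure \<mu> B" "emeasure \<mu> B < emeasure \<mu> {c}"
      using nonatomic_\<mu> s unfolding nonatomic_def by (metis not_gr_zero)
    then show False by (auto simp: subset_singleton_iff)
  qed
  then have "{c} \<in> null_sets \<mu>" using s by auto
  from AE_not_in[OF this] show ?thesis by simp
next
  case False
  then show ?thesis by (intro AE_I2) (auto simp: space_\<mu>)
qed

text \<open>The intervals \<open>{0..x}\<close> form a \<open>\<pi>\<close>-system generating the Borel sets of \<open>[0,1]\<close>, so a signed
  measure \<open>g d\<mu>\<close> that vanishes on all of them is zero.\<close>

lemma AE_eq_0_of_primitive:
  fixes g :: "real \<Rightarrow> real"
  assumes g: "integrable \<mu> g" and 0: "\<And>x. x \<in> {0..1} \<Longrightarrow> set_lebesgue_integral \<mu> {0..x} g = 0"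
  shows "AE x in \<mu>. g x = 0"
proof (rule density_zero[OF g])
  have si: "set_integrable \<mu> A g" if "A \<in> sets \<mu>" for A
    unfolding set_integrable_def using that g by (rule integrable_mult_indicator)
  have I0: "set_lebesgue_integral \<mu> {0..1} g = 0" using 0[of 1] by simp
  have B0: "set_lebesgue_integral \<mu> (B \<inter> {0..1}) g = 0" if "B \<in> sets borel" for B
  proof -
    have "Int_stable (range (atMost :: real \<Rightarrow> _))"
      by (auto simp: Int_stable_def)
    moreover have "range (atMost :: real \<Rightarrow> _) \<subseteq> Pow UNIV" by auto
    moreover have "B \<in> sigma_sets UNIV (range (atMost :: real \<Rightarrow> _))"
      using that by (simp add: borel_eq_atMost)
    ultimately show ?thesis
    proof (induction rule: sigma_sets_induct_disjoint)
      case (basic A)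
      then obtain x :: real where A: "A = {..x}" by auto
      have "A \<inter> {0..1} = {0..min x 1}" by (auto simp: A)
      moreover have "set_lebesgue_integral \<mu> {0..min x 1} g = 0"
      proof (cases "x < 0")
        case True
        then show ?thesis by (simp add: set_lebesgue_integral_def)
      next
        case False
        then show ?thesis by (intro 0) auto
      qed
      ultimately show ?case by simp
    next
      case empty
      then show ?case by (simp add: set_lebesgue_integral_def)
    next
      case (compl A)
      then have A: "A \<in> sets borel" by (simp add: borel_eq_atMost)
      have "set_lebesgue_integral \<mu> ((A \<inter> {0..1}) \<union> ((UNIV - A) \<inter> {0..1})) g
          = set_lebesgue_integral \<mu> (A \<inter> {0..1}) g
          + set_lebesgue_integral \<mu> ((UNIV - A) \<inter> {0..1}) g"
        using A by (intro set_integral_Un si borel_Int_in_sets) auto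
      moreover have "(A \<inter> {0..1}) \<union> ((UNIV - A) \<inter> {0..1}) = {0..1}" by auto
      ultimately show ?case using compl I0 by simp
    next
      case (union F)
      then have F: "F i \<in> sets borel" for i by (auto simp: borel_eq_atMost)
      have "set_lebesgue_integral \<mu> (\<Union>i. F i \<inter> {0..1}) g
          = (\<Sum>i. set_lebesgue_integral \<mu> (F i \<inter> {0..1}) g)"
      proof (rule lebesgue_integral_countable_add)
        show "F i \<inter> {0..1} \<in> sets \<mu>" for i using F borel_Int_in_sets by auto
        show "F i \<inter> {0..1} \<inter> (F j \<inter> {0..1}) = {}" if "i \<noteq> j" for i j
          using union(1) that by (auto simp: disjoint_family_on_def)
        show "set_integrable \<mu> (\<Union>i. F i \<inter> {0..1}) g"
          using F borel_Int_in_sets by (intro si sets.countable_UN) auto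
      qed
      moreover have "(\<Union>i. F i \<inter> {0..1}) = \<Union> (range F) \<inter> {0..1}" by auto
      ultimately show ?case using union by simp
    qed
  qed
  fix A assume "A \<in> sets \<mu>"
  then obtain B where "B \<in> sets borel" "A = {0..1} \<inter> B"
    unfolding sets_\<mu> sets_restrict_space by blast
  then show "set_lebesgue_integral \<mu> A g = 0"
    using B0 by (simp add: Int_commute)
qed

text \<open>A jump of the primitive would be an atom of \<open>\<mu>\<close>.\<close>

lemma continuous_primitive:
  fixes g :: "real \<Rightarrow> real"
  assumes g: "integrable \<mu> g"
  shows "continuous_on {0..1} (\<lambda>x. set_lebesgue_integral \<mu> {0..x} g)"
proof (rule continuous_on_sequentiallyI)
  fix u :: "nat \<Rightarrow> real" and a assume u: "\<forall>n. u n \<in> {0..1}" and a: "a \<in> {0..1}" and lim: "u \<longlonglongrightarrow> a"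
  have [measurable]: "g \<in> borel_measurable \<mu>" using g by auto
  have meas: "(\<lambda>y. indicator {0..x} y *\<^sub>R g y) \<in> borel_measurable \<mu>" if "x \<in> {0..1}" for x
    using that interval_in_sets[of x] by (intro borel_measurable_scaleR borel_measurable_indicator) auto
  show "(\<lambda>n. set_lebesgue_integral \<mu> {0..u n} g) \<longlonglongrightarrow> set_lebesgue_integral \<mu> {0..a} g"
    unfolding set_lebesgue_integral_def
  proof (rule integral_dominated_convergence)
    show "integrable \<mu> (\<lambda>x. norm (g x))" using g by auto
    show "AE x in \<mu>. (\<lambda>n. indicator {0..u n} x *\<^sub>R g x) \<longlonglongrightarrow> indicator {0..a} x *\<^sub>R g x"
      using AE_neq[of a]
    proof eventually_elim
      case (elim y)
      have "eventually (\<lambda>n. indicator {0..u n} y *\<^sub>R g y = indicator {0..a} y *\<^sub>R g y) sequentially"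
      proof (cases "y < a")
        case True
        from order_tendstoD(1)[OF lim this] show ?thesis
          by eventually_elim (use True in \<open>auto simp: indicator_def\<close>)
      next
        case False
        then have "a < y" using elim by simp
        from order_tendstoD(2)[OF lim this] show ?thesis
          by eventually_elim (use False elim in \<open>auto simp: indicator_def\<close>)
      qed
      then show ?case by (rule tendsto_eventually)
    qed
    show "AE x in \<mu>. norm (indicator {0..u n} x *\<^sub>R g x) \<le> norm (g x)" for n
      by (auto simp: indicator_def)
  qed (use u a meas in auto)
qed

lemma has_mu_deriv_iff:
  "has_mu_deriv \<mu> f g \<longleftrightarrow> g \<in> L2 \<mu> \<and> integrable \<mu> g \<and>
     (\<forall>x\<in>{0..1}. f x = f 0 + set_lebesgue_integral \<mu> {0..x} g)"
proof -
  have "set_integrable \<mu> {0..1} g \<longleftrightarrow> integrable \<mu> g"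
    unfolding set_integrable_def by (rule Bochner_Integration.integrable_cong) (auto simp: space_\<mu>)
  moreover have "set_integrable \<mu> {0..x} g" if "x \<in> {0..1}" "integrable \<mu> g" for x
    unfolding set_integrable_def using that interval_in_sets[of x] by (intro integrable_mult_indicator) auto
  ultimately show ?thesis
    unfolding has_mu_deriv_def by (metis atLeastAtMost_iff order_refl zero_le_one)
qed

lemma has_mu_deriv_primitive:
  assumes "has_mu_deriv \<mu> f g" "x \<in> {0..1}"
  shows "set_lebesgue_integral \<mu> {0..x} g = f x - f 0"
proof -
  have "f x = f 0 + set_lebesgue_integral \<mu> {0..x} g"
    using assms unfolding has_mu_deriv_def by blast
  then show ?thesis by linarith
qed

lemma has_mu_deriv_continuous:
  assumes "has_mu_deriv \<mu> f g" shows "continuous_on {0..1} f"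
proof -
  have "continuous_on {0..1} (\<lambda>x. f 0 + set_lebesgue_integral \<mu> {0..x} g)"
    using assms by (intro continuous_intros continuous_primitive) (auto simp: has_mu_deriv_iff)
  then show ?thesis
    using assms unfolding has_mu_deriv_iff by (metis (no_types, lifting) continuous_on_cong)
qed

lemma has_mu_deriv_lincomb:
  assumes u: "has_mu_deriv \<mu> u g" and v: "has_mu_deriv \<mu> v h"
  shows "has_mu_deriv \<mu> (\<lambda>x. a * u x + b * v x) (\<lambda>x. a * g x + b * h x)"
  unfolding has_mu_deriv_iff
proof (intro conjI ballI)
  have int: "integrable \<mu> g" "integrable \<mu> h" using u v by (auto simp: has_mu_deriv_iff)
  show "(\<lambda>x. a * g x + b * h x) \<in> L2 \<mu>"
    using u v by (intro L2_lincomb) (auto simp: has_mu_deriv_iff)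
  show "integrable \<mu> (\<lambda>x. a * g x + b * h x)" using int by auto
  fix x :: real assume x: "x \<in> {0..1}"
  then have si: "set_integrable \<mu> {0..x} g" "set_integrable \<mu> {0..x} h"
    using u v by (auto simp: has_mu_deriv_def)
  have "set_lebesgue_integral \<mu> {0..x} (\<lambda>x. a * g x + b * h x)
      = a * set_lebesgue_integral \<mu> {0..x} g + b * set_lebesgue_integral \<mu> {0..x} h"
    using si by (simp add: set_integral_add set_integrable_mult_right)
  moreover have "u x = u 0 + set_lebesgue_integral \<mu> {0..x} g"
      "v x = v 0 + set_lebesgue_integral \<mu> {0..x} h"
    using u v x unfolding has_mu_deriv_def by blast+
  ultimately show "a * u x + b * v x
      = a * u 0 + b * v 0 + set_lebesgue_integral \<mu> {0..x} (\<lambda>x. a * g x + b * h x)"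
    by (simp add: algebra_simps)
qed

text \<open>Since members of the domain are continuous, equality Lebesgue-almost everywhere is
  equality on \<open>[0,1]\<close>, even when \<open>\<mu>\<close> and Lebesgue measure are mutually singular. This is
  what makes the derivative an operator on classes.\<close>

lemma has_mu_deriv_AE_eq:
  assumes u: "has_mu_deriv \<mu> u g" and v: "has_mu_deriv \<mu> v h" and ae: "AE x in lamJ. u x = v x"
  shows "AE x in \<mu>. g x = h x"
proof -
  let ?w = "\<lambda>x. 1 * u x + (-1) * v x" and ?k = "\<lambda>x. 1 * g x + (-1) * h x"
  have w: "has_mu_deriv \<mu> ?w ?k" by (rule has_mu_deriv_lincomb[OF u v])
  have "AE x in lamJ. ?w x = 0" using ae by eventually_elim simp
  then have w0: "?w x = 0" if "x \<in> {0..1}" for x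
    using continuous_on_AE_eq_0[OF has_mu_deriv_continuous[OF w]] that by blast
  have "set_lebesgue_integral \<mu> {0..x} ?k = 0" if "x \<in> {0..1}" for x
    using has_mu_deriv_primitive[OF w that] w0[OF that] w0[of 0] by simp
  then have "AE x in \<mu>. ?k x = 0"
    using w by (intro AE_eq_0_of_primitive) (auto simp: has_mu_deriv_iff)
  then show ?thesis by eventually_elim simp
qed

lemma T_mu_has_mu_deriv: "f \<in> dom_T \<mu> \<Longrightarrow> has_mu_deriv \<mu> f (T_mu \<mu> f)"
  unfolding dom_T_def T_mu_def using someI_ex[of "has_mu_deriv \<mu> f"] by blast

lemma dom_T_subset_L2: "dom_T \<mu> \<subseteq> L2 lamJ"
  by (auto simp: dom_T_def intro: continuous_on_L2_lamJ has_mu_deriv_continuous)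

lemma fun_subspace_dom_T: "fun_subspace (dom_T \<mu>)"
  unfolding fun_subspace_def
proof (intro conjI ballI allI)
  have "has_mu_deriv \<mu> (\<lambda>x. 0) (\<lambda>x. 0)"
    by (simp add: has_mu_deriv_iff L2_zero set_lebesgue_integral_def)
  then show "(\<lambda>x. 0) \<in> dom_T \<mu>" by (auto simp: dom_T_def)
  show "(\<lambda>x. a * u x + b * v x) \<in> dom_T \<mu>" if "u \<in> dom_T \<mu>" "v \<in> dom_T \<mu>" for u v a b
    using that by (auto simp: dom_T_def intro: has_mu_deriv_lincomb)
qed

lemma l2_operator_T_mu: "l2_operator lamJ (dom_T \<mu>) \<mu> (L2 \<mu>) (T_mu \<mu>)"
  unfolding l2_operator_def
proof (intro conjI ballI allI impI)
  fix u v a b assume uv: "u \<in> dom_T \<mu>" "v \<in> dom_T \<mu>"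
  then have "(\<lambda>x. a * u x + b * v x) \<in> dom_T \<mu>"
    using fun_subspace_dom_T by (auto simp: fun_subspace_def)
  then show "AE x in \<mu>. T_mu \<mu> (\<lambda>y. a * u y + b * v y) x = a * T_mu \<mu> u x + b * T_mu \<mu> v x"
    by (rule has_mu_deriv_AE_eq[OF T_mu_has_mu_deriv
          has_mu_deriv_lincomb[OF T_mu_has_mu_deriv[OF uv(1)] T_mu_has_mu_deriv[OF uv(2)]]]) simp
next
  fix u v assume "u \<in> dom_T \<mu>" "v \<in> dom_T \<mu>" "AE x in lamJ. u x = v x"
  then show "AE x in \<mu>. T_mu \<mu> u x = T_mu \<mu> v x"
    using has_mu_deriv_AE_eq[OF T_mu_has_mu_deriv T_mu_has_mu_deriv] by blast
next
  show "T_mu \<mu> u \<in> L2 \<mu>" if "u \<in> dom_T \<mu>" for u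
    using T_mu_has_mu_deriv[OF that] by (simp add: has_mu_deriv_iff)
qed (fact dom_T_subset_L2 fun_subspace_dom_T)+

lemma l2_hilbert_scrL2: "l2_hilbert lamJ (scrL2 \<mu>)"
  unfolding scrL2_def by (rule l2_hilbert_closure[OF dom_T_subset_L2 fun_subspace_dom_T])

lemma dom_T_subset_scrL2: "dom_T \<mu> \<subseteq> scrL2 \<mu>"
  unfolding scrL2_def by (rule subset_l2_closure[OF dom_T_subset_L2])

end

section \<open>Test functions and integration by parts\<close>

lemma test_function_has_derivative:
  assumes "\<phi> \<in> test_functions" shows "(\<phi> has_real_derivative deriv \<phi> x) (at x)"
proof -
  have "(deriv ^^ 0) \<phi> differentiable_on UNIV"
    using assms unfolding test_functions_def by blast
  then show ?thesis
    by (simp add: differentiable_on_def DERIV_deriv_iff_real_differentiable)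
qed

lemma test_function_continuous: "\<phi> \<in> test_functions \<Longrightarrow> continuous_on S \<phi>"
  using test_function_has_derivative
  by (meson DERIV_isCont continuous_at_imp_continuous_on)

lemma test_function_deriv_continuous:
  assumes "\<phi> \<in> test_functions" shows "continuous_on S (deriv \<phi>)"
proof -
  have "(deriv ^^ 1) \<phi> differentiable_on UNIV"
    using assms unfolding test_functions_def by blast
  then have "deriv \<phi> differentiable_on UNIV" by simp
  then show ?thesis
    using differentiable_imp_continuous_on continuous_on_subset by blast
qed

lemma test_function_eq_0:
  assumes "\<phi> \<in> test_functions" "x \<le> 0 \<or> 1 \<le> x" shows "\<phi> x = 0"
proof (rule ccontr)
  assume "\<phi> x \<noteq> 0"
  then have "x \<in> closure {x. \<phi> x \<noteq> 0}" by (intro subsetD[OF closure_subset]) simp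
  then have "x \<in> interior {0..1}" using assms(1) by (auto simp: test_functions_def)
  then show False using assms(2) by simp
qed

lemma test_function_deriv_L2: "\<phi> \<in> test_functions \<Longrightarrow> (\<lambda>x. - deriv \<phi> x) \<in> L2 lamJ"
  by (intro continuous_on_L2_lamJ continuous_intros test_function_deriv_continuous)

lemma integral_deriv_test_function:
  assumes \<phi>: "\<phi> \<in> test_functions" and y: "0 \<le> y" "y \<le> 1"
  shows "(\<integral>x. deriv \<phi> x * (if y \<le> x then 1 else 0) \<partial>lamJ) = - \<phi> y"
proof -
  have "(\<integral>x. deriv \<phi> x * (if y \<le> x then 1 else 0) \<partial>lamJ)
      = (\<integral>x. indicator {0..1} x *\<^sub>R (deriv \<phi> x * (if y \<le> x then 1 else 0)) \<partial>lborel)"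
    unfolding lamJ_def by (rule integral_restrict_space) simp
  also have "\<dots> = (\<integral>x. indicator {y..1} x *\<^sub>R deriv \<phi> x \<partial>lborel)"
    using y by (intro Bochner_Integration.integral_cong) (auto simp: indicator_def)
  also have "\<dots> = \<phi> 1 - \<phi> y"
  proof (rule integral_FTC_atLeastAtMost[OF y(2)])
    show "(\<phi> has_vector_derivative deriv \<phi> x) (at x within {y..1})" for x
      using test_function_has_derivative[OF \<phi>, of x]
      by (simp add: has_real_derivative_iff_has_vector_derivative has_vector_derivative_at_within)
  qed (rule test_function_deriv_continuous[OF \<phi>])
  finally show ?thesis using test_function_eq_0[OF \<phi>, of 1] by simp
qed

context nonatomic_unit_measure
begin

text \<open>Substituting \<open>f x = f 0 + \<integral>\<^sub>[\<^sub>0\<^sub>,\<^sub>x\<^sub>] g d\<mu>\<close> and exchanging the order of integration over the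
  triangle \<open>0 \<le> y \<le> x \<le> 1\<close>, the inner integral of \<open>\<phi>'\<close> over \<open>[y,1]\<close> is \<open>- \<phi> y\<close>.\<close>

lemma integration_by_parts:
  assumes \<phi>: "\<phi> \<in> test_functions" and fg: "has_mu_deriv \<mu> f g"
  shows "(\<integral>x. deriv \<phi> x * f x \<partial>lamJ) = - (\<integral>y. \<phi> y * g y \<partial>\<mu>)"
proof -
  interpret lam: finite_measure lamJ by (rule finite_measure_lamJ)
  interpret P: pair_sigma_finite lamJ \<mu> ..
  have g: "integrable \<mu> g" using fg by (simp add: has_mu_deriv_iff)
  then have gm[measurable]: "g \<in> borel_measurable \<mu>" by auto
  have dc: "continuous_on {0..1} (deriv \<phi>)" by (rule test_function_deriv_continuous[OF \<phi>])
  have fc: "continuous_on {0..1} f" by (rule has_mu_deriv_continuous[OF fg])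
  have dm[measurable]: "deriv \<phi> \<in> borel_measurable lamJ"
    by (rule continuous_on_imp_measurable[OF sets_lamJ dc])
  have idm: "(\<lambda>x. x) \<in> borel_measurable lamJ" "(\<lambda>x. x) \<in> borel_measurable \<mu>"
    by (intro continuous_on_imp_measurable sets_lamJ sets_\<mu> continuous_intros)+
  have [measurable]: "fst \<in> borel_measurable (lamJ \<Otimes>\<^sub>M \<mu>)" "snd \<in> borel_measurable (lamJ \<Otimes>\<^sub>M \<mu>)"
    using measurable_compose[OF measurable_fst idm(1)] measurable_compose[OF measurable_snd idm(2)]
    by auto
  obtain B where B: "\<And>x. x \<in> {0..1} \<Longrightarrow> \<bar>deriv \<phi> x\<bar> \<le> B"
    using continuous_on_unit_bounded[OF dc] by blast
  define H where "H x y = deriv \<phi> x * ((if y \<le> x then 1 else 0) * g y)" for x y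
  have meas: "case_prod H \<in> borel_measurable (lamJ \<Otimes>\<^sub>M \<mu>)"
    unfolding H_def case_prod_beta by measurable
  have Hx: "integrable \<mu> (H x)" if "x \<in> space lamJ" for x
    unfolding H_def using g
  proof (intro integrable_mult_right Bochner_Integration.integrable_bound[OF g])
    show "(\<lambda>y. (if y \<le> x then 1 else 0) * g y) \<in> borel_measurable \<mu>"
      using idm(2) by measurable
  qed auto
  have int: "integrable (lamJ \<Otimes>\<^sub>M \<mu>) (case_prod H)"
  proof (rule P.Fubini_integrable[OF meas])
    have nH: "(\<lambda>p. norm (case_prod H p)) \<in> borel_measurable (lamJ \<Otimes>\<^sub>M \<mu>)"
      using meas by measurable
    show "integrable lamJ (\<lambda>x. \<integral>y. norm (case_prod H (x, y)) \<partial>\<mu>)"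
    proof (rule lam.integrable_const_bound)
      show "(\<lambda>x. \<integral>y. norm (case_prod H (x, y)) \<partial>\<mu>) \<in> borel_measurable lamJ"
        using nH by (intro borel_measurable_lebesgue_integral) (simp add: case_prod_beta)
      show "AE x in lamJ. norm (\<integral>y. norm (case_prod H (x, y)) \<partial>\<mu>) \<le> (\<integral>y. B * \<bar>g y\<bar> \<partial>\<mu>)"
      proof (rule AE_I2)
        fix x assume x: "x \<in> space lamJ"
        then have Bx: "\<bar>deriv \<phi> x\<bar> \<le> B" using B by (simp add: space_lamJ)
        have "(\<integral>y. norm (H x y) \<partial>\<mu>) \<le> (\<integral>y. B * \<bar>g y\<bar> \<partial>\<mu>)"
        proof (rule integral_mono)
          show "norm (H x y) \<le> B * \<bar>g y\<bar>" for y
            using Bx by (auto simp: H_def abs_mult intro!: mult_right_mono)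
        qed (use Hx[OF x] g in auto)
        then show "norm (\<integral>y. norm (case_prod H (x, y)) \<partial>\<mu>) \<le> (\<integral>y. B * \<bar>g y\<bar> \<partial>\<mu>)"
          by simp
      qed
    qed
    show "AE x in lamJ. integrable \<mu> (\<lambda>y. case_prod H (x, y))"
      using Hx by (intro AE_I2) simp
  qed
  have inner_y: "(\<integral>y. H x y \<partial>\<mu>) = deriv \<phi> x * f x - deriv \<phi> x * f 0" if "x \<in> space lamJ" for x
  proof -
    have "(\<integral>y. (if y \<le> x then 1 else 0) * g y \<partial>\<mu>) = set_lebesgue_integral \<mu> {0..x} g"
      unfolding set_lebesgue_integral_def
      by (intro Bochner_Integration.integral_cong) (auto simp: space_\<mu> indicator_def)
    also have "\<dots> = f x - f 0"
      using fg that by (intro has_mu_deriv_primitive) (auto simp: space_lamJ)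
    finally show ?thesis by (simp add: H_def right_diff_distrib)
  qed
  have inner_x: "(\<integral>x. H x y \<partial>lamJ) = - (\<phi> y * g y)" if "y \<in> space \<mu>" for y
  proof -
    have "(\<integral>x. H x y \<partial>lamJ) = (\<integral>x. (deriv \<phi> x * (if y \<le> x then 1 else 0)) * g y \<partial>lamJ)"
      by (simp add: H_def mult.assoc)
    also have "\<dots> = (\<integral>x. deriv \<phi> x * (if y \<le> x then 1 else 0) \<partial>lamJ) * g y"
      by simp
    finally show ?thesis
      using that integral_deriv_test_function[OF \<phi>, of y] by (simp add: space_\<mu>)
  qed
  have "(\<integral>x. deriv \<phi> x \<partial>lamJ) = (\<integral>x. deriv \<phi> x * (if 0 \<le> x then 1 else 0) \<partial>lamJ)"
    by (intro Bochner_Integration.integral_cong) (auto simp: space_lamJ)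
  then have d0: "(\<integral>x. deriv \<phi> x \<partial>lamJ) = 0"
    using integral_deriv_test_function[OF \<phi>, of 0] test_function_eq_0[OF \<phi>, of 0] by simp
  have "- (\<integral>y. \<phi> y * g y \<partial>\<mu>) = (\<integral>y. (\<integral>x. H x y \<partial>lamJ) \<partial>\<mu>)"
    by (simp add: inner_x cong: Bochner_Integration.integral_cong)
  also have "\<dots> = (\<integral>x. (\<integral>y. H x y \<partial>\<mu>) \<partial>lamJ)"
    by (rule P.Fubini_integral[OF int])
  also have "\<dots> = (\<integral>x. deriv \<phi> x * f x - deriv \<phi> x * f 0 \<partial>lamJ)"
    by (rule Bochner_Integration.integral_cong) (auto simp: inner_y)
  also have "\<dots> = (\<integral>x. deriv \<phi> x * f x \<partial>lamJ) - (\<integral>x. deriv \<phi> x * f 0 \<partial>lamJ)"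
    using dc fc by (intro Bochner_Integration.integral_diff continuous_on_integrable_lamJ continuous_intros)
  finally show ?thesis by (simp add: d0)
qed

end

section \<open>Smooth bump functions\<close>

definition smooth :: "(real \<Rightarrow> real) \<Rightarrow> bool" where
  "smooth f \<longleftrightarrow> (\<forall>n. (deriv ^^ n) f differentiable_on UNIV)"

text \<open>The way smoothness is proved throughout: membership in some family that is closed
  under differentiation. This avoids formulas for higher derivatives.\<close>

lemma smooth_coinduct:
  assumes f: "f \<in> F"
    and F: "\<And>g. g \<in> F \<Longrightarrow> \<exists>g'\<in>F. \<forall>x. (g has_real_derivative g' x) (at x)"
  shows "smooth f"
proof -
  have "(deriv ^^ n) f \<in> F" for n
  proof (induction n)
    case (Suc n)
    obtain g' where g': "g' \<in> F" "\<And>x. ((deriv ^^ n) f has_real_derivative g' x) (at x)"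
      using F[OF Suc] by blast
    then have "deriv ((deriv ^^ n) f) = g'" by (auto intro: DERIV_imp_deriv)
    then show ?case using g' by simp
  qed (use f in simp)
  then show ?thesis
    unfolding smooth_def differentiable_on_def
    by (metis F differentiable_at_withinI real_differentiable_def)
qed

lemma smooth_has_derivative:
  assumes "smooth f" shows "(f has_real_derivative deriv f x) (at x)"
proof -
  have "(deriv ^^ 0) f differentiable_on UNIV" using assms unfolding smooth_def by blast
  then show ?thesis
    by (simp add: differentiable_on_def DERIV_deriv_iff_real_differentiable)
qed

lemma smooth_deriv: "smooth f \<Longrightarrow> smooth (deriv f)"
  unfolding smooth_def by (metis comp_apply funpow_Suc_right)

text \<open>By the product rule, derivatives of products are sums of products of smooth functions.
  Closing the products under addition therefore gives a family stable under differentiation,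
  and with constant factors it also contains linear combinations.\<close>

inductive_set sums_of_smooth_products :: "(real \<Rightarrow> real) set" where
  mult: "smooth f \<Longrightarrow> smooth g \<Longrightarrow> (\<lambda>x. f x * g x) \<in> sums_of_smooth_products"
| add: "u \<in> sums_of_smooth_products \<Longrightarrow> v \<in> sums_of_smooth_products \<Longrightarrow>
    (\<lambda>x. u x + v x) \<in> sums_of_smooth_products"

lemma smooth_sums_of_smooth_products:
  assumes "f \<in> sums_of_smooth_products" shows "smooth f"
proof (rule smooth_coinduct[OF assms])
  fix g assume "g \<in> sums_of_smooth_products"
  then show "\<exists>g'\<in>sums_of_smooth_products. \<forall>x. (g has_real_derivative g' x) (at x)"
  proof induction
    case (mult f g)
    have "(\<lambda>x. deriv f x * g x + f x * deriv g x) \<in> sums_of_smooth_products"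
      using mult by (intro sums_of_smooth_products.intros smooth_deriv)
    moreover have "((\<lambda>x. f x * g x) has_real_derivative deriv f x * g x + f x * deriv g x) (at x)" for x
      using DERIV_mult[OF smooth_has_derivative[OF mult(1)] smooth_has_derivative[OF mult(2)], of x]
      by (simp add: algebra_simps)
    ultimately show ?case
      by (intro bexI[of _ "\<lambda>x. deriv f x * g x + f x * deriv g x"]) auto
  next
    case (add u v)
    then obtain u' v' where "u' \<in> sums_of_smooth_products" "v' \<in> sums_of_smooth_products"
      "\<forall>x. (u has_real_derivative u' x) (at x)" "\<forall>x. (v has_real_derivative v' x) (at x)"
      by blast
    then show ?case
      by (intro bexI[of _ "\<lambda>x. u' x + v' x"] sums_of_smooth_products.add) (auto intro: DERIV_add)
  qed
qed

lemma smooth_mult: "smooth f \<Longrightarrow> smooth g \<Longrightarrow> smooth (\<lambda>x. f x * g x)"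
  using smooth_sums_of_smooth_products[OF sums_of_smooth_products.mult] .

lemma smooth_const: "smooth (\<lambda>x. c)"
  by (rule smooth_coinduct[of _ "range (\<lambda>c x. c)"]) (auto intro!: exI[of _ 0])

lemma smooth_lincomb:
  assumes "smooth f" "smooth g" shows "smooth (\<lambda>x. a * f x + b * g x)"
  using smooth_sums_of_smooth_products[OF sums_of_smooth_products.add[
        OF sums_of_smooth_products.mult[OF smooth_const assms(1)]
          sums_of_smooth_products.mult[OF smooth_const assms(2)]]] .

text \<open>Cauchy's flat function \<open>exp (- 1 / x)\<close>, with a polynomial factor that makes the family
  closed under differentiation.\<close>

definition flat :: "real poly \<Rightarrow> real \<Rightarrow> real" where
  "flat p x = (if 0 < x then poly p (1 / x) * exp (- (1 / x)) else 0)"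

lemma tendsto_poly_exp_0: "((\<lambda>y :: real. poly p y * exp (- y)) \<longlongrightarrow> 0) at_top"
proof -
  have "((\<lambda>y. \<Sum>i\<le>degree p. coeff p i * (y ^ i / exp y)) \<longlongrightarrow> (\<Sum>i\<le>degree p. coeff p i * 0)) at_top"
    by (intro tendsto_intros tendsto_power_div_exp_0)
  moreover have "(\<lambda>y. \<Sum>i\<le>degree p. coeff p i * (y ^ i / exp y)) = (\<lambda>y. poly p y * exp (- y))"
    by (simp add: poly_altdef sum_distrib_right exp_minus divide_inverse mult.assoc)
  ultimately show ?thesis by simp
qed

lemma flat_has_derivative:
  "(flat p has_real_derivative flat ([:0, 0, 1:] * (p - pderiv p)) x) (at x)"
proof (cases x "0 :: real" rule: linorder_cases)
  case less
  have "((\<lambda>x. 0) has_real_derivative 0) (at x)" by simp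
  then have "(flat p has_real_derivative 0) (at x)"
    by (rule has_field_derivative_transform_within_open[of _ _ _ "{..<0}"])
      (use less in \<open>auto simp: flat_def\<close>)
  then show ?thesis using less by (simp add: flat_def)
next
  case greater
  have "((\<lambda>x. poly p (1 / x) * exp (- (1 / x))) has_real_derivative
      poly ([:0, 0, 1:] * (p - pderiv p)) (1 / x) * exp (- (1 / x))) (at x)"
    using greater
    by (auto intro!: derivative_eq_intros DERIV_chain2[OF poly_DERIV]
        simp: power2_eq_square field_simps)
  then have "(flat p has_real_derivative
      poly ([:0, 0, 1:] * (p - pderiv p)) (1 / x) * exp (- (1 / x))) (at x)"
    by (rule has_field_derivative_transform_within_open[of _ _ _ "{0<..}"])
      (use greater in \<open>auto simp: flat_def\<close>)
  then show ?thesis using greater by (simp add: flat_def)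
next
  case equal
  have "((\<lambda>h. poly (pCons 0 p) (inverse h) * exp (- inverse h)) \<longlongrightarrow> 0) (at_right 0)"
    by (rule filterlim_compose[OF tendsto_poly_exp_0 filterlim_inverse_at_top_right])
  moreover have "eventually (\<lambda>h. poly (pCons 0 p) (inverse h) * exp (- inverse h) = flat p h / h)
      (at_right (0 :: real))"
    using eventually_at_right_less[of "0 :: real"]
    by eventually_elim (simp add: flat_def divide_inverse)
  ultimately have "((\<lambda>h. flat p h / h) \<longlongrightarrow> 0) (at_right 0)"
    by (rule Lim_transform_eventually)
  moreover have "((\<lambda>h. flat p h / h) \<longlongrightarrow> 0) (at_left 0)"
  proof (rule tendsto_eventually)
    have "eventually (\<lambda>h. h < 0) (at_left (0 :: real))" by (simp add: eventually_at_filter)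
    then show "eventually (\<lambda>h. flat p h / h = 0) (at_left 0)"
      by eventually_elim (simp add: flat_def)
  qed
  ultimately have "((\<lambda>h. flat p h / h) \<longlongrightarrow> 0) (at 0)" by (intro filterlim_split_at)
  then show ?thesis using equal by (simp add: DERIV_def flat_def)
qed

lemma smooth_flat_affine: "smooth (\<lambda>x. flat p (c * x + d))"
proof (rule smooth_coinduct[of _ "range (\<lambda>p x. flat p (c * x + d))"])
  fix g assume "g \<in> range (\<lambda>p x. flat p (c * x + d))"
  then obtain p where g: "g = (\<lambda>x. flat p (c * x + d))" by auto
  let ?q = "smult c ([:0, 0, 1:] * (p - pderiv p))"
  have "(g has_real_derivative flat ?q (c * x + d)) (at x)" for x
  proof -
    have "((\<lambda>x. c * x + d) has_real_derivative c) (at x)"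
      by (auto intro!: derivative_eq_intros)
    from DERIV_chain2[OF flat_has_derivative this, of p]
    have "(g has_real_derivative flat ([:0, 0, 1:] * (p - pderiv p)) (c * x + d) * c) (at x)"
      by (simp add: g)
    moreover have "flat ([:0, 0, 1:] * (p - pderiv p)) (c * x + d) * c = flat ?q (c * x + d)"
      by (simp add: flat_def)
    ultimately show ?thesis by (simp only:)
  qed
  then show "\<exists>g'\<in>range (\<lambda>p x. flat p (c * x + d)). \<forall>x. (g has_real_derivative g' x) (at x)"
    by (intro bexI[of _ "\<lambda>x. flat ?q (c * x + d)"]) auto
qed auto

text \<open>For \<open>n > 0\<close> this is the \<open>n\<close>-th root of the bump with parameter \<open>1\<close>. It stays smooth and
  supported in \<open>[a,b]\<close> and converges to the indicator of \<open>(a,b)\<close> as \<open>n\<close> grows, so that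
  indicators of intervals are limits of test functions without any mollification.\<close>

definition bump :: "real \<Rightarrow> real \<Rightarrow> nat \<Rightarrow> real \<Rightarrow> real" where
  "bump a b n x = flat 1 (real n * (x - a)) * flat 1 (real n * (b - x))"

lemma flat_1: "flat 1 x = (if 0 < x then exp (- (1 / x)) else 0)"
  by (simp add: flat_def)

lemma flat_1_bounds: "0 \<le> flat 1 x" "flat 1 x \<le> 1"
  by (auto simp: flat_1)

lemma flat_1_mono:
  assumes "0 < x" "x \<le> y" shows "flat 1 x \<le> flat 1 y"
  using assms by (auto simp: flat_1 intro!: divide_left_mono)

lemma bump_bounds: "0 \<le> bump a b n x" "bump a b n x \<le> indicator {a<..<b} x"
proof -
  show "0 \<le> bump a b n x" by (simp add: bump_def flat_1_bounds)
  have "bump a b n x \<le> 1 * 1"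
    unfolding bump_def by (intro mult_mono flat_1_bounds) simp
  moreover have "bump a b n x = 0" if "x \<notin> {a<..<b}"
    using that by (auto simp: bump_def flat_1 zero_less_mult_iff)
  ultimately show "bump a b n x \<le> indicator {a<..<b} x" by (auto simp: indicator_def)
qed

lemma bump_test_function:
  assumes "0 < a" "b < 1" shows "bump a b n \<in> test_functions"
proof -
  have "smooth (\<lambda>x. flat 1 (real n * x + (- real n * a)) * flat 1 ((- real n) * x + real n * b))"
    by (intro smooth_mult smooth_flat_affine)
  also have "(\<lambda>x. flat 1 (real n * x + (- real n * a)) * flat 1 ((- real n) * x + real n * b)) = bump a b n"
    by (auto simp: bump_def algebra_simps)
  finally have "smooth (bump a b n)" .
  moreover have "closure {x. bump a b n x \<noteq> 0} \<subseteq> {a..b}"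
  proof (rule closure_minimal)
    show "{x. bump a b n x \<noteq> 0} \<subseteq> {a..b}"
    proof
      fix x assume "x \<in> {x. bump a b n x \<noteq> 0}"
      then have "0 < bump a b n x" using bump_bounds(1)[of a b n x] by simp
      then have "0 < (indicator {a<..<b} x :: real)" using bump_bounds(2)[of a b n x] by linarith
      then show "x \<in> {a..b}" by (auto simp: indicator_def split: if_splits)
    qed
  qed simp
  ultimately show ?thesis
    using assms by (fastforce simp: test_functions_def smooth_def)
qed

lemma bump_tendsto_indicator: "(\<lambda>n. bump a b n x) \<longlonglongrightarrow> indicator {a<..<b} x"
proof (cases "x \<in> {a<..<b}")
  case True
  have lim: "(\<lambda>n. flat 1 (real n * c)) \<longlonglongrightarrow> 1" if "c > 0" for c
  proof (rule Lim_transform_eventually)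
    have "(\<lambda>n. exp (- (inverse (real n) * inverse c))) \<longlonglongrightarrow> exp (- (0 * inverse c))"
      by (intro tendsto_intros lim_inverse_n)
    then show "(\<lambda>n. exp (- (inverse (real n) * inverse c))) \<longlonglongrightarrow> 1" by simp
    show "eventually (\<lambda>n. exp (- (inverse (real n) * inverse c)) = flat 1 (real n * c)) sequentially"
      using eventually_gt_at_top[of 0]
      by eventually_elim (use that in \<open>auto simp: flat_1 divide_inverse\<close>)
  qed
  have "(\<lambda>n. bump a b n x) \<longlonglongrightarrow> 1 * 1"
    unfolding bump_def using True by (intro tendsto_mult lim) auto
  then show ?thesis using True by simp
next
  case False
  then have "bump a b n x = 0" for n
    using bump_bounds[of a b n x] by simp
  then show ?thesis using False by simp
qed

lemma test_functions_iff:
  "\<phi> \<in> test_functions \<longleftrightarrow> smooth \<phi> \<and> closure {x. \<phi> x \<noteq> 0} \<subseteq> interior {0..1}"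
  by (simp add: test_functions_def smooth_def)

lemma test_functions_lincomb:
  assumes "\<phi> \<in> test_functions" "\<psi> \<in> test_functions"
  shows "(\<lambda>x. a * \<phi> x + b * \<psi> x) \<in> test_functions"
proof -
  have "closure {x. a * \<phi> x + b * \<psi> x \<noteq> 0} \<subseteq> closure ({x. \<phi> x \<noteq> 0} \<union> {x. \<psi> x \<noteq> 0})"
    by (intro closure_mono) auto
  also have "\<dots> \<subseteq> interior {0..1}"
    using assms by (simp add: test_functions_iff)
  finally show ?thesis
    using assms by (simp add: test_functions_iff smooth_lincomb)
qed

lemma fun_subspace_test_functions: "fun_subspace test_functions"
  by (auto simp: fun_subspace_def test_functions_lincomb)
    (simp add: test_functions_iff smooth_const)

section \<open>Density of the test functions\<close>

context nonatomic_unit_measure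
begin

lemma indicator_borel_measurable:
  assumes "B \<in> sets borel" shows "(indicator B :: real \<Rightarrow> real) \<in> borel_measurable \<mu>"
proof -
  have "(indicator (B \<inter> {0..1}) :: real \<Rightarrow> real) \<in> borel_measurable \<mu>"
    by (intro borel_measurable_indicator borel_Int_in_sets assms)
  then show ?thesis
    by (rule subst[OF measurable_cong, rotated]) (auto simp: space_\<mu> indicator_def)
qed

text \<open>A function orthogonal to all bumps has integral zero over every open subinterval.
  The dominating function is a fixed larger bump, bounded below on \<open>(a,b)\<close> by a
  constant \<open>m > 0\<close>.\<close>

lemma integral_subinterval_eq_0:
  assumes test: "test_functions \<subseteq> L2 \<mu>" and w: "w \<in> L2 \<mu>"
    and orth: "\<And>\<phi>. \<phi> \<in> test_functions \<Longrightarrow> l2_inner \<mu> \<phi> w = 0"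
    and ab: "0 < a" "b < 1"
  shows "integrable \<mu> (\<lambda>x. indicator {a<..<b} x * w x)"
    and "(\<integral>x. indicator {a<..<b} x * w x \<partial>\<mu>) = 0"
proof -
  define \<psi> where "\<psi> = bump (a / 2) ((1 + b) / 2) 1"
  define m where "m = flat 1 (a / 2) * flat 1 ((1 - b) / 2)"
  have m: "m > 0" using ab by (simp add: m_def flat_1)
  have "\<psi> \<in> L2 \<mu>" using bump_test_function[of "a / 2" "(1 + b) / 2" 1] ab test by (auto simp: \<psi>_def)
  then have "integrable \<mu> (\<lambda>x. \<psi> x * w x)" using w by (rule L2_mult_integrable)
  then have dom: "integrable \<mu> (\<lambda>x. \<bar>\<psi> x * w x\<bar> / m)" by simp
  have le: "indicator {a<..<b} x \<le> \<psi> x / m" for x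
  proof (cases "x \<in> {a<..<b}")
    case True
    then have "m \<le> \<psi> x"
      unfolding m_def \<psi>_def bump_def
      using ab by (intro mult_mono flat_1_mono flat_1_bounds) (auto simp: field_simps)
    then show ?thesis using m True by simp
  next
    case False
    then show ?thesis using m bump_bounds(1) by (simp add: \<psi>_def)
  qed
  have \<psi>0: "0 \<le> \<psi> x" for x using bump_bounds(1) by (simp add: \<psi>_def)
  have bd: "\<bar>c * w x\<bar> \<le> \<bar>\<psi> x * w x\<bar> / m" if "0 \<le> c" "c \<le> indicator {a<..<b} x" for c x
  proof -
    have "c * \<bar>w x\<bar> \<le> (\<psi> x / m) * \<bar>w x\<bar>"
      using le[of x] that by (intro mult_right_mono) auto
    then show ?thesis using that \<psi>0[of x] by (simp add: abs_mult)
  qed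
  have [measurable]: "(indicator {a<..<b} :: real \<Rightarrow> real) \<in> borel_measurable \<mu>"
    by (rule indicator_borel_measurable) simp
  have [measurable]: "w \<in> borel_measurable \<mu>" using w by (simp add: L2_iff)
  have bm: "(\<lambda>x. bump a b n x * w x) \<in> borel_measurable \<mu>" for n
  proof -
    have "bump a b n \<in> L2 \<mu>" using bump_test_function[OF ab] test by blast
    then show ?thesis by (intro borel_measurable_times) (auto simp: L2_iff)
  qed
  show "integrable \<mu> (\<lambda>x. indicator {a<..<b} x * w x)"
    by (rule Bochner_Integration.integrable_bound[OF dom]) (use bd m in \<open>auto intro!: AE_I2\<close>)
  have "(\<lambda>n. \<integral>x. bump a b n x * w x \<partial>\<mu>) \<longlonglongrightarrow> (\<integral>x. indicator {a<..<b} x * w x \<partial>\<mu>)"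
  proof (rule integral_dominated_convergence[OF _ _ dom])
    show "AE x in \<mu>. (\<lambda>n. bump a b n x * w x) \<longlonglongrightarrow> indicator {a<..<b} x * w x"
      by (intro AE_I2 tendsto_intros bump_tendsto_indicator)
    show "AE x in \<mu>. norm (bump a b n x * w x) \<le> \<bar>\<psi> x * w x\<bar> / m" for n
      using bd bump_bounds by (intro AE_I2) simp
  qed (use bm in auto)
  moreover have "(\<integral>x. bump a b n x * w x \<partial>\<mu>) = 0" for n
    using orth[OF bump_test_function[OF ab]] by (simp add: l2_inner_def)
  ultimately show "(\<integral>x. indicator {a<..<b} x * w x \<partial>\<mu>) = 0"
    by (simp add: LIMSEQ_const_iff)
qed

text \<open>Vanishing of the integrals over \<open>(a, min x b)\<close> says that the restriction of \<open>w\<close> to \<open>(a,b)\<close>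
  has primitive zero. The intervals \<open>(1/n, 1 - 1/n)\<close> exhaust \<open>[0,1]\<close> up to its endpoints, which
  are null sets.\<close>

lemma AE_eq_0_of_orthogonal_test_functions:
  assumes test: "test_functions \<subseteq> L2 \<mu>" and w: "w \<in> L2 \<mu>"
    and orth: "\<And>\<phi>. \<phi> \<in> test_functions \<Longrightarrow> l2_inner \<mu> \<phi> w = 0"
  shows "AE x in \<mu>. w x = 0"
proof -
  note int = integral_subinterval_eq_0[OF test w orth]
  have sub: "AE x in \<mu>. indicator {a<..<b} x * w x = 0" if ab: "0 < a" "b < 1" for a b
  proof (rule AE_eq_0_of_primitive)
    show "integrable \<mu> (\<lambda>x. indicator {a<..<b} x * w x)" by (rule int(1)[OF _ ab])
    fix x :: real assume x: "x \<in> {0..1}"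
    have "set_lebesgue_integral \<mu> {0..x} (\<lambda>y. indicator {a<..<b} y * w y)
        = (\<integral>y. indicator {a<..<min x b} y * w y \<partial>\<mu>)"
      unfolding set_lebesgue_integral_def
    proof (rule integral_cong_AE)
      have wm: "w \<in> borel_measurable \<mu>" using w by (simp add: L2_iff)
      then show "(\<lambda>y. indicator {0..x} y *\<^sub>R (indicator {a<..<b} y * w y)) \<in> borel_measurable \<mu>"
        "(\<lambda>y. indicator {a<..<min x b} y * w y) \<in> borel_measurable \<mu>"
        by (intro borel_measurable_scaleR borel_measurable_times indicator_borel_measurable; simp)+
      \<comment> \<open>The two integrands differ at most at the point \<open>x\<close>.\<close>
      show "AE y in \<mu>. indicator {0..x} y *\<^sub>R (indicator {a<..<b} y * w y)
          = indicator {a<..<min x b} y * w y"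
        using AE_neq[of x]
        by eventually_elim (use ab in \<open>auto simp: indicator_def\<close>)
    qed
    also have "\<dots> = 0"
      using int(2)[OF _ ab(1), of "min x b"] ab(2) by simp
    finally show "set_lebesgue_integral \<mu> {0..x} (\<lambda>y. indicator {a<..<b} y * w y) = 0" .
  qed
  have "AE x in \<mu>. \<forall>n. indicator {1 / real (Suc n)<..<1 - 1 / real (Suc n)} x * w x = 0"
    by (subst AE_all_countable) (intro allI sub, auto)
  then show ?thesis
    using AE_neq[of 0] AE_neq[of 1] AE_space
  proof eventually_elim
    case (elim x)
    then have "0 < min x (1 - x)" by (auto simp: space_\<mu>)
    from reals_Archimedean[OF this] obtain n where "inverse (real (Suc n)) < min x (1 - x)" by blast
    then have "x \<in> {1 / real (Suc n)<..<1 - 1 / real (Suc n)}" by (auto simp: inverse_eq_divide)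
    then show ?case using elim(1)[rule_format, of n] by simp
  qed
qed

lemma l2_dense_test_functions:
  assumes test: "test_functions \<subseteq> L2 \<mu>"
  shows "l2_dense_subspace \<mu> (L2 \<mu>) test_functions"
  unfolding l2_dense_subspace_def
proof (intro conjI test fun_subspace_test_functions subsetI)
  fix v assume v: "v \<in> L2 \<mu>"
  let ?H = "l2_closure \<mu> test_functions"
  obtain p where p: "is_l2_proj \<mu> ?H v p"
    using l2_projection_exists[OF l2_hilbert_closure[OF test fun_subspace_test_functions] v] by blast
  then have pH: "p \<in> ?H" by (simp add: is_l2_proj_def)
  then have pL: "p \<in> L2 \<mu>" by (simp add: l2_closure_iff)
  have eq: "AE x in \<mu>. v x - p x = 0"
  proof (rule AE_eq_0_of_orthogonal_test_functions[OF test L2_diff[OF v pL]])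
    show "l2_inner \<mu> \<phi> (\<lambda>x. v x - p x) = 0" if "\<phi> \<in> test_functions" for \<phi>
      using p that subset_l2_closure[OF test] by (auto simp: is_l2_proj_def)
  qed
  have "l2_inner \<mu> (\<lambda>x. f x - v x) (\<lambda>x. f x - v x) = l2_inner \<mu> (\<lambda>x. f x - p x) (\<lambda>x. f x - p x)"
    if "f \<in> test_functions" for f
    unfolding l2_inner_def
  proof (rule integral_cong_AE)
    have [measurable]: "f \<in> borel_measurable \<mu>" "v \<in> borel_measurable \<mu>" "p \<in> borel_measurable \<mu>"
      using that test v pL by (auto simp: L2_iff)
    show "(\<lambda>x. (f x - v x) * (f x - v x)) \<in> borel_measurable \<mu>"
      "(\<lambda>x. (f x - p x) * (f x - p x)) \<in> borel_measurable \<mu>" by measurable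
    show "AE x in \<mu>. (f x - v x) * (f x - v x) = (f x - p x) * (f x - p x)"
      using eq by eventually_elim simp
  qed
  then show "v \<in> ?H" using pH v by (simp add: l2_closure_iff)
qed

end

section \<open>The dual pair\<close>

context nonatomic_unit_measure
begin

lemma D_op_is_proj:
  assumes "\<phi> \<in> test_functions"
  shows "is_l2_proj lamJ (scrL2 \<mu>) (\<lambda>x. - deriv \<phi> x) (D_op \<mu> \<phi>)"
  unfolding D_op_def
  by (rule someI_ex[OF l2_projection_exists[OF l2_hilbert_scrL2 test_function_deriv_L2[OF assms]]])

lemma D_op_in_scrL2: "\<phi> \<in> test_functions \<Longrightarrow> D_op \<mu> \<phi> \<in> scrL2 \<mu>"
  using D_op_is_proj by (simp add: is_l2_proj_def)

lemma scrL2_subset_L2: "scrL2 \<mu> \<subseteq> L2 lamJ"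
  using l2_hilbert_scrL2 by (simp add: l2_hilbert_def)

lemma D_op_eq_deriv:
  assumes \<phi>: "\<phi> \<in> test_functions" and d: "(\<lambda>x. - deriv \<phi> x) \<in> scrL2 \<mu>"
  shows "AE x in lamJ. D_op \<mu> \<phi> x = - deriv \<phi> x"
proof -
  have "is_l2_proj lamJ (scrL2 \<mu>) (\<lambda>x. - deriv \<phi> x) (\<lambda>x. - deriv \<phi> x)"
    using d by (simp add: is_l2_proj_def l2_inner_def)
  then show ?thesis
    by (rule l2_proj_unique[OF l2_hilbert_scrL2 test_function_deriv_L2[OF \<phi>] D_op_is_proj[OF \<phi>]])
qed

text \<open>Elements of the domain lie in the closed subspace, so projecting \<open>- \<phi>'\<close> onto it does
  not change the inner products, and integration by parts gives the adjoint relation.\<close>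

lemma T_mu_D_op_adjoint:
  assumes u: "u \<in> dom_T \<mu>" and \<phi>: "\<phi> \<in> test_functions"
  shows "l2_inner \<mu> (T_mu \<mu> u) \<phi> = l2_inner lamJ u (D_op \<mu> \<phi>)"
proof -
  have uH: "u \<in> scrL2 \<mu>" using u dom_T_subset_scrL2 by blast
  then have uL: "u \<in> L2 lamJ" using scrL2_subset_L2 by blast
  have DL: "D_op \<mu> \<phi> \<in> L2 lamJ" using D_op_in_scrL2[OF \<phi>] scrL2_subset_L2 by blast
  have "l2_inner lamJ u (\<lambda>x. - deriv \<phi> x - D_op \<mu> \<phi> x) = 0"
    using D_op_is_proj[OF \<phi>] uH by (simp add: is_l2_proj_def)
  then have "l2_inner lamJ u (D_op \<mu> \<phi>) = l2_inner lamJ u (\<lambda>x. - deriv \<phi> x)"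
    using l2_inner_diff_right[OF test_function_deriv_L2[OF \<phi>] DL uL] by simp
  also have "\<dots> = - (\<integral>x. deriv \<phi> x * u x \<partial>lamJ)"
    by (simp add: l2_inner_def mult.commute)
  also have "\<dots> = l2_inner \<mu> (T_mu \<mu> u) \<phi>"
    using integration_by_parts[OF \<phi> T_mu_has_mu_deriv[OF u]]
    by (simp add: l2_inner_def mult.commute)
  finally show ?thesis ..
qed

text \<open>The class of \<open>\<phi>\<close> in \<open>L\<^sup>2(\<mu>)\<close> determines \<open>D \<phi>\<close>: by the adjoint relation it determines the
  inner products of \<open>D \<phi>\<close> with a dense subspace.\<close>

lemma D_op_cong_AE:
  assumes \<phi>: "\<phi> \<in> test_functions \<inter> L2 \<mu>" and \<psi>: "\<psi> \<in> test_functions \<inter> L2 \<mu>"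
    and eq: "AE x in \<mu>. \<phi> x = \<psi> x"
  shows "AE x in lamJ. D_op \<mu> \<phi> x = D_op \<mu> \<psi> x"
proof -
  let ?d = "\<lambda>x. 1 * D_op \<mu> \<phi> x + (-1) * D_op \<mu> \<psi> x"
  have H: "D_op \<mu> \<phi> \<in> scrL2 \<mu>" "D_op \<mu> \<psi> \<in> scrL2 \<mu>" using \<phi> \<psi> D_op_in_scrL2 by auto
  then have L: "D_op \<mu> \<phi> \<in> L2 lamJ" "D_op \<mu> \<psi> \<in> L2 lamJ" using scrL2_subset_L2 by auto
  have dH: "?d \<in> l2_closure lamJ (dom_T \<mu>)"
    using l2_hilbert_scrL2 H unfolding l2_hilbert_def fun_subspace_def scrL2_def by blast
  have dL: "?d \<in> L2 lamJ" by (rule L2_lincomb[OF L])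
  have "l2_inner lamJ u ?d = 0" if u: "u \<in> dom_T \<mu>" for u
  proof -
    have Tm: "T_mu \<mu> u \<in> borel_measurable \<mu>"
      using T_mu_has_mu_deriv[OF u] by (auto simp: has_mu_deriv_iff)
    have "l2_inner \<mu> (T_mu \<mu> u) \<phi> = l2_inner \<mu> (T_mu \<mu> u) \<psi>"
      unfolding l2_inner_def
    proof (rule integral_cong_AE)
      show "AE x in \<mu>. T_mu \<mu> u x * \<phi> x = T_mu \<mu> u x * \<psi> x"
        using eq by eventually_elim simp
    qed (use Tm \<phi> \<psi> in \<open>auto simp: L2_iff\<close>)
    then have "l2_inner lamJ u (D_op \<mu> \<phi>) = l2_inner lamJ u (D_op \<mu> \<psi>)"
      using T_mu_D_op_adjoint[OF u] \<phi> \<psi> by simp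
    then show ?thesis
      using u dom_T_subset_L2 by (subst l2_inner_lincomb_right[OF L]) auto
  qed
  then have "l2_inner lamJ ?d ?d = 0"
    by (rule l2_inner_eq_0_closure[OF dom_T_subset_L2 dL _ dH])
  then have "AE x in lamJ. ?d x = 0" by (rule l2_inner_self_eq_0_AE[OF dL])
  then show ?thesis by eventually_elim simp
qed

lemma D_op_lincomb:
  assumes \<phi>: "\<phi> \<in> test_functions" and \<psi>: "\<psi> \<in> test_functions"
  shows "AE x in lamJ. D_op \<mu> (\<lambda>y. a * \<phi> y + b * \<psi> y) x = a * D_op \<mu> \<phi> x + b * D_op \<mu> \<psi> x"
proof -
  let ?\<chi> = "\<lambda>y. a * \<phi> y + b * \<psi> y"
  have \<chi>: "?\<chi> \<in> test_functions" using \<phi> \<psi> by (rule test_functions_lincomb)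
  have "deriv ?\<chi> x = a * deriv \<phi> x + b * deriv \<psi> x" for x
    by (intro DERIV_imp_deriv DERIV_add DERIV_cmult test_function_has_derivative \<phi> \<psi>)
  then have "(\<lambda>x. - deriv ?\<chi> x) = (\<lambda>x. a * (- deriv \<phi> x) + b * (- deriv \<psi> x))"
    by auto
  then have "is_l2_proj lamJ (scrL2 \<mu>) (\<lambda>x. - deriv ?\<chi> x) (\<lambda>x. a * D_op \<mu> \<phi> x + b * D_op \<mu> \<psi> x)"
    using l2_proj_lincomb[OF l2_hilbert_scrL2 test_function_deriv_L2[OF \<phi>]
        test_function_deriv_L2[OF \<psi>] D_op_is_proj[OF \<phi>] D_op_is_proj[OF \<psi>]] by simp
  then show ?thesis
    by (rule l2_proj_unique[OF l2_hilbert_scrL2 test_function_deriv_L2[OF \<chi>] D_op_is_proj[OF \<chi>]])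
qed

lemma l2_operator_D_op:
  "l2_operator \<mu> (test_functions \<inter> L2 \<mu>) lamJ (scrL2 \<mu>) (D_op \<mu>)"
proof -
  have "fun_subspace (test_functions \<inter> L2 \<mu>)"
    using fun_subspace_test_functions fun_subspace_L2[of \<mu>] by (auto simp: fun_subspace_def)
  then show ?thesis
    unfolding l2_operator_def using D_op_in_scrL2 D_op_lincomb D_op_cong_AE by blast
qed

lemma formally_adjoint_T_mu_D_op:
  "formally_adjoint lamJ (scrL2 \<mu>) (dom_T \<mu>)
     \<mu> (L2 \<mu>) (test_functions \<inter> L2 \<mu>) (T_mu \<mu>) (D_op \<mu>)"
  unfolding formally_adjoint_def
  using l2_hilbert_scrL2 l2_hilbert_L2 dom_T_subset_scrL2 l2_operator_T_mu l2_operator_D_op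
    T_mu_D_op_adjoint by blast

lemma l2_dense_dom_T: "l2_dense_subspace lamJ (scrL2 \<mu>) (dom_T \<mu>)"
  using dom_T_subset_scrL2 fun_subspace_dom_T by (simp add: l2_dense_subspace_def scrL2_def)

lemma integrable_deriv_times:
  assumes "\<phi> \<in> test_functions" "f \<in> dom_T \<mu>"
  shows "integrable lamJ (\<lambda>x. deriv \<phi> x * f x)"
  using assms has_mu_deriv_continuous[OF T_mu_has_mu_deriv]
  by (intro continuous_on_integrable_lamJ continuous_on_mult test_function_deriv_continuous)

lemma integrable_times_T_mu:
  assumes \<phi>: "\<phi> \<in> test_functions" and f: "f \<in> dom_T \<mu>"
  shows "integrable \<mu> (\<lambda>x. \<phi> x * T_mu \<mu> f x)"
proof -
  have T: "integrable \<mu> (T_mu \<mu> f)"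
    using T_mu_has_mu_deriv[OF f] unfolding has_mu_deriv_iff by blast
  have c: "continuous_on {0..1} \<phi>" by (rule test_function_continuous[OF \<phi>])
  obtain B where B: "\<And>x. x \<in> {0..1} \<Longrightarrow> \<bar>\<phi> x\<bar> \<le> B"
    using continuous_on_unit_bounded[OF c] by blast
  show ?thesis
  proof (rule Bochner_Integration.integrable_bound)
    show "integrable \<mu> (\<lambda>x. B * \<bar>T_mu \<mu> f x\<bar>)" using T by simp
    show "(\<lambda>x. \<phi> x * T_mu \<mu> f x) \<in> borel_measurable \<mu>"
      using T continuous_on_imp_measurable[OF sets_\<mu> c] by simp
    show "AE x in \<mu>. norm (\<phi> x * T_mu \<mu> f x) \<le> norm (B * \<bar>T_mu \<mu> f x\<bar>)"
    proof (rule AE_I2)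
      fix x assume "x \<in> space \<mu>"
      then have "\<bar>\<phi> x\<bar> \<le> \<bar>B\<bar>" using B[of x] by (simp add: space_\<mu>)
      then show "norm (\<phi> x * T_mu \<mu> f x) \<le> norm (B * \<bar>T_mu \<mu> f x\<bar>)"
        by (simp add: abs_mult mult_right_mono)
    qed
  qed
qed

end

theorem theorem3p1:
  fixes \<mu> :: "real measure"
  assumes "sets \<mu> = sets (restrict_space borel {0..1})"
    and "sigma_finite_measure \<mu>"
    and "nonatomic \<mu>"
  shows "(\<forall>\<phi>\<in>test_functions. \<forall>f\<in>dom_T \<mu>.
            integrable lamJ (\<lambda>x. deriv \<phi> x * f x) \<and>
            integrable \<mu> (\<lambda>x. \<phi> x * T_mu \<mu> f x) \<and>
            - (\<integral>x. deriv \<phi> x * f x \<partial>lamJ) = (\<integral>x. \<phi> x * T_mu \<mu> f x \<partial>\<mu>)) \<and>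
         (\<forall>\<phi>\<in>test_functions.
            is_l2_proj lamJ (scrL2 \<mu>) (\<lambda>x. - deriv \<phi> x) (D_op \<mu> \<phi>) \<and>
            ((\<lambda>x. - deriv \<phi> x) \<in> scrL2 \<mu> \<longrightarrow>
               (AE x in lamJ. D_op \<mu> \<phi> x = - deriv \<phi> x))) \<and>
         l2_dense_subspace lamJ (scrL2 \<mu>) (dom_T \<mu>) \<and>
         formally_adjoint lamJ (scrL2 \<mu>) (dom_T \<mu>)
            \<mu> (L2 \<mu>) (test_functions \<inter> L2 \<mu>) (T_mu \<mu>) (D_op \<mu>) \<and>
         (test_functions \<subseteq> L2 \<mu> \<longrightarrow>
            symmetric_pair lamJ (scrL2 \<mu>) (dom_T \<mu>)
              \<mu> (L2 \<mu>) test_functions (T_mu \<mu>) (D_op \<mu>))"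
proof -
  interpret nonatomic_unit_measure \<mu>
    using assms by (intro nonatomic_unit_measure.intro nonatomic_unit_measure_axioms.intro)
  have parts: "- (\<integral>x. deriv \<phi> x * f x \<partial>lamJ) = (\<integral>x. \<phi> x * T_mu \<mu> f x \<partial>\<mu>)"
    if "\<phi> \<in> test_functions" "f \<in> dom_T \<mu>" for \<phi> f
    using integration_by_parts[OF that(1) T_mu_has_mu_deriv[OF that(2)]] by simp
  have pair: "symmetric_pair lamJ (scrL2 \<mu>) (dom_T \<mu>)
      \<mu> (L2 \<mu>) test_functions (T_mu \<mu>) (D_op \<mu>)" if "test_functions \<subseteq> L2 \<mu>"
    using that formally_adjoint_T_mu_D_op l2_dense_dom_T l2_dense_test_functions
    by (simp add: symmetric_pair_def Int_absorb2)
  show ?thesis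
    using integrable_deriv_times integrable_times_T_mu parts D_op_is_proj
      D_op_eq_deriv l2_dense_dom_T formally_adjoint_T_mu_D_op pair
    by (intro conjI ballI impI) auto
qed

end
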